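(* Suppose the randomized Exponential Time Hypothesis is true. Then there exists $\epsilon>0$ such that \textsc{CP-Dec} on instances with a binary alphabet cannot be solved in time $2^{\epsilon n^2}\cdot m^{O(1)}$, where $n$ is the total number of slots and $m$ the number of words in the dictionary. This holds also for instances where all slots have distinct sizes (so words cannot be reused).
   Context: A crossword instance consists of a dictionary $\mathcal{D}$ of $m$ words over an alphabet $\mathcal{L}$, and a grid of cells containing $n$ slots; a slot is a set of consecutive cells in a row (horizontal) or column (vertical). Horizontal slots are pairwise disjoint, vertical slots are pairwise disjoint; a cell in two slots is shared. A feasible solution assigns to each slot $S$ either a word of $\mathcal{D}$ of length exactly $|S|$ or nothing; horizontal words left to right, vertical words top to bottom; intersecting filled slots must agree on their shared cell. \textsc{CP-Dec} asks whether the grid can be completely filled (every slot receives a word). The randomized Exponential Time Hypothesis states that there exists $\epsilon>0$ such that 3-SAT on instances with $n$ variables and $m$ clauses cannot be solved by a randomized algorithm with expected running time $2^{\epsilon(n+m)}$. *)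

theory Defs
  imports "HOL-Probability.Infinite_Product_Measure" "HOL-Probability.Probability_Mass_Function"
begin

text \<open>
  Algorithms are programs of the language WHILE over binary trees (Jones, ``Computability and
  Complexity''), extended by a coin flip. Elementary tree operations have unit cost; there is no
  unit-cost comparison of trees other than with \<open>NIL\<close>. In this model and on (multitape) Turing
  machines, running times agree up to polynomials in the running time and the input length.
\<close>

datatype data = NIL | CONS data data

fun hd_data :: "data \<Rightarrow> data" where
  "hd_data NIL = NIL"
| "hd_data (CONS a b) = a"

fun tl_data :: "data \<Rightarrow> data" where
  "tl_data NIL = NIL"
| "tl_data (CONS a b) = b"

fun data_size :: "data \<Rightarrow> nat" where
  "data_size NIL = 1"
| "data_size (CONS a b) = 1 + data_size a + data_size b"

datatype expr = EVar nat | ENil | ECons expr expr | EHd expr | ETl expr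

datatype com =
    Assign nat expr
  | Flip nat
  | Seq com com
  | If expr com com
  | While expr com

type_synonym store = "nat \<Rightarrow> data"

fun eval_expr :: "expr \<Rightarrow> store \<Rightarrow> data" where
  "eval_expr (EVar x) s = s x"
| "eval_expr ENil s = NIL"
| "eval_expr (ECons e f) s = CONS (eval_expr e s) (eval_expr f s)"
| "eval_expr (EHd e) s = hd_data (eval_expr e s)"
| "eval_expr (ETl e) s = tl_data (eval_expr e s)"

fun expr_cost :: "expr \<Rightarrow> nat" where
  "expr_cost (EVar x) = 1"
| "expr_cost ENil = 1"
| "expr_cost (ECons e f) = 1 + expr_cost e + expr_cost f"
| "expr_cost (EHd e) = 1 + expr_cost e"
| "expr_cost (ETl e) = 1 + expr_cost e"

text \<open>
  \<open>exec \<omega> c (s, k) t (s', k')\<close>: with coin outcomes \<open>\<omega> 0, \<omega> 1, \<dots>\<close>, of which the first \<open>k\<close> are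
  already used up, \<open>c\<close> started in store \<open>s\<close> terminates after time \<open>t\<close> in store \<open>s'\<close>, the first
  \<open>k'\<close> coins then being used up.
\<close>

inductive exec ::
  "(nat \<Rightarrow> bool) \<Rightarrow> com \<Rightarrow> store \<times> nat \<Rightarrow> nat \<Rightarrow> store \<times> nat \<Rightarrow> bool" for \<omega> where
  Assign: "exec \<omega> (Assign x e) (s, k) (1 + expr_cost e) (s(x := eval_expr e s), k)"
| Flip: "exec \<omega> (Flip x) (s, k) 1 (s(x := (if \<omega> k then CONS NIL NIL else NIL)), Suc k)"
| Seq: "exec \<omega> c1 \<sigma>1 t1 \<sigma>2 \<Longrightarrow> exec \<omega> c2 \<sigma>2 t2 \<sigma>3 \<Longrightarrow> exec \<omega> (Seq c1 c2) \<sigma>1 (t1 + t2) \<sigma>3"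
| IfTrue: "eval_expr e s \<noteq> NIL \<Longrightarrow> exec \<omega> c1 (s, k) t \<sigma> \<Longrightarrow>
    exec \<omega> (If e c1 c2) (s, k) (1 + expr_cost e + t) \<sigma>"
| IfFalse: "eval_expr e s = NIL \<Longrightarrow> exec \<omega> c2 (s, k) t \<sigma> \<Longrightarrow>
    exec \<omega> (If e c1 c2) (s, k) (1 + expr_cost e + t) \<sigma>"
| WhileFalse: "eval_expr e s = NIL \<Longrightarrow>
    exec \<omega> (While e c) (s, k) (1 + expr_cost e) (s, k)"
| WhileTrue: "eval_expr e s \<noteq> NIL \<Longrightarrow> exec \<omega> c (s, k) t1 \<sigma>1 \<Longrightarrow>
    exec \<omega> (While e c) \<sigma>1 t2 \<sigma>2 \<Longrightarrow>
    exec \<omega> (While e c) (s, k) (1 + expr_cost e + t1 + t2) \<sigma>2"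

text \<open>Variable \<open>0\<close> holds the input and, on termination, the answer (\<open>NIL\<close> meaning ``no'').\<close>

definition run :: "com \<Rightarrow> data \<Rightarrow> (nat \<Rightarrow> bool) \<Rightarrow> nat \<Rightarrow> bool \<Rightarrow> bool" where
  "run p x \<omega> t b \<longleftrightarrow>
     (\<exists>s k. exec \<omega> p ((\<lambda>_. NIL)(0 := x), 0) t (s, k) \<and> b = (s 0 \<noteq> NIL))"

fun deterministic :: "com \<Rightarrow> bool" where
  "deterministic (Assign x e) \<longleftrightarrow> True"
| "deterministic (Flip x) \<longleftrightarrow> False"
| "deterministic (Seq c1 c2) \<longleftrightarrow> deterministic c1 \<and> deterministic c2"
| "deterministic (If e c1 c2) \<longleftrightarrow> deterministic c1 \<and> deterministic c2"
| "deterministic (While e c) \<longleftrightarrow> deterministic c"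

definition coins :: "(nat \<Rightarrow> bool) measure" where
  "coins = PiM UNIV (\<lambda>_. measure_pmf (bernoulli_pmf (1/2)))"

text \<open>The infimum ranges over at most one value; it is \<open>\<infinity>\<close> for a diverging run.\<close>

definition runtime :: "com \<Rightarrow> data \<Rightarrow> (nat \<Rightarrow> bool) \<Rightarrow> ennreal" where
  "runtime p x \<omega> = (INF t \<in> {t. \<exists>b. run p x \<omega> t b}. of_nat t)"

definition expected_runtime :: "com \<Rightarrow> data \<Rightarrow> ennreal" where
  "expected_runtime p x = (\<integral>\<^sup>+ \<omega>. runtime p x \<omega> \<partial>coins)"

fun enc_bool :: "bool \<Rightarrow> data" where
  "enc_bool False = NIL"
| "enc_bool True = CONS NIL NIL"

fun enc_list :: "('a \<Rightarrow> data) \<Rightarrow> 'a list \<Rightarrow> data" where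
  "enc_list f [] = NIL"
| "enc_list f (x # xs) = CONS (f x) (enc_list f xs)"

text \<open>
  Numbers are encoded in unary. All numbers below are variable indices of a formula or coordinates
  in a grid, so this is polynomial in the number of variables and clauses, resp. in the size of
  the explicitly drawn grid.
\<close>

fun enc_nat :: "nat \<Rightarrow> data" where
  "enc_nat 0 = NIL"
| "enc_nat (Suc n) = CONS NIL (enc_nat n)"

text \<open>The literal \<open>(v, b)\<close> is true iff variable \<open>v\<close> has value \<open>b\<close>.\<close>

type_synonym literal = "nat \<times> bool"

record cnf =
  num_vars :: nat
  clauses :: "literal list list"

definition is_3cnf :: "cnf \<Rightarrow> bool" where
  "is_3cnf \<phi> \<longleftrightarrow> (\<forall>c \<in> set (clauses \<phi>). length c \<le> 3 \<and> (\<forall>(v, b) \<in> set c. v < num_vars \<phi>))"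

definition num_clauses :: "cnf \<Rightarrow> nat" where
  "num_clauses \<phi> = length (clauses \<phi>)"

definition satisfiable :: "cnf \<Rightarrow> bool" where
  "satisfiable \<phi> \<longleftrightarrow> (\<exists>\<alpha> :: nat \<Rightarrow> bool. \<forall>c \<in> set (clauses \<phi>). \<exists>(v, b) \<in> set c. \<alpha> v = b)"

definition enc_cnf :: "cnf \<Rightarrow> data" where
  "enc_cnf \<phi> = CONS (enc_nat (num_vars \<phi>))
     (enc_list (enc_list (\<lambda>(v, b). CONS (enc_nat v) (enc_bool b))) (clauses \<phi>))"

text \<open>
  Randomized algorithms are Las Vegas algorithms: every terminating run is correct, only the
  running time is random (and a finite expectation forces termination with probability 1).
\<close>

definition solves_3sat_expected :: "com \<Rightarrow> (cnf \<Rightarrow> real) \<Rightarrow> bool" where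
  "solves_3sat_expected p T \<longleftrightarrow> (\<forall>\<phi>. is_3cnf \<phi> \<longrightarrow>
     (\<forall>\<omega> t b. run p (enc_cnf \<phi>) \<omega> t b \<longrightarrow> b = satisfiable \<phi>) \<and>
     expected_runtime p (enc_cnf \<phi>) \<le> ennreal (T \<phi>))"

definition randomized_ETH :: bool where
  "randomized_ETH \<longleftrightarrow> (\<exists>\<epsilon>>0. \<not> (\<exists>p C. solves_3sat_expected p
     (\<lambda>\<phi>. C * 2 powr (\<epsilon> * real (num_vars \<phi> + num_clauses \<phi>)))))"

datatype orientation = Horizontal | Vertical

record slot =
  orient :: orientation
  start_row :: nat
  start_col :: nat
  slot_len :: nat

fun cell_at :: "slot \<Rightarrow> nat \<Rightarrow> nat \<times> nat" where
  "cell_at S i = (case orient S of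
     Horizontal \<Rightarrow> (start_row S, start_col S + i)
   | Vertical \<Rightarrow> (start_row S + i, start_col S))"

definition cells :: "slot \<Rightarrow> (nat \<times> nat) set" where
  "cells S = cell_at S ` {..<slot_len S}"

text \<open>The alphabet is the type \<^typ>\<open>'l\<close>.\<close>

record 'l crossword =
  dict :: "'l list list"
  height :: nat
  width :: nat
  slots :: "slot list"

definition valid_crossword :: "'l crossword \<Rightarrow> bool" where
  "valid_crossword I \<longleftrightarrow>
     distinct (dict I) \<and> distinct (slots I) \<and>
     (\<forall>S \<in> set (slots I). slot_len S > 0 \<and> cells S \<subseteq> {..<height I} \<times> {..<width I}) \<and>
     (\<forall>S \<in> set (slots I). \<forall>T \<in> set (slots I).
        S \<noteq> T \<and> orient S = orient T \<longrightarrow> cells S \<inter> cells T = {})"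

definition num_words :: "'l crossword \<Rightarrow> nat" where
  "num_words I = length (dict I)"

definition num_slots :: "'l crossword \<Rightarrow> nat" where
  "num_slots I = length (slots I)"

definition feasible :: "'l crossword \<Rightarrow> (slot \<Rightarrow> 'l list option) \<Rightarrow> bool" where
  "feasible I f \<longleftrightarrow>
     (\<forall>S \<in> set (slots I). \<forall>w. f S = Some w \<longrightarrow> w \<in> set (dict I) \<and> length w = slot_len S) \<and>
     (\<forall>S \<in> set (slots I). \<forall>T \<in> set (slots I). \<forall>u v. f S = Some u \<longrightarrow> f T = Some v \<longrightarrow>
        (\<forall>i < slot_len S. \<forall>j < slot_len T. cell_at S i = cell_at T j \<longrightarrow> u ! i = v ! j))"

definition completely_fillable :: "'l crossword \<Rightarrow> bool" where
  "completely_fillable I \<longleftrightarrow> (\<exists>f. feasible I f \<and> (\<forall>S \<in> set (slots I). f S \<noteq> None))"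

definition distinct_slot_sizes :: "'l crossword \<Rightarrow> bool" where
  "distinct_slot_sizes I \<longleftrightarrow> inj_on slot_len (set (slots I))"

fun enc_slot :: "slot \<Rightarrow> data" where
  "enc_slot S = CONS (enc_bool (orient S = Vertical))
     (CONS (enc_nat (start_row S)) (CONS (enc_nat (start_col S)) (enc_nat (slot_len S))))"

definition enc_crossword :: "bool crossword \<Rightarrow> data" where
  "enc_crossword I = CONS (enc_list (enc_list enc_bool) (dict I))
     (CONS (enc_nat (height I)) (CONS (enc_nat (width I)) (enc_list enc_slot (slots I))))"

definition input_size :: "bool crossword \<Rightarrow> nat" where
  "input_size I = data_size (enc_crossword I)"

text \<open>
  The program \<open>p\<close> is only required to be correct, and to meet the time bound \<open>T\<close>, on the instances
  in \<open>X\<close>.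
\<close>

definition solves_CP_Dec :: "com \<Rightarrow> bool crossword set \<Rightarrow> (bool crossword \<Rightarrow> real) \<Rightarrow> bool" where
  "solves_CP_Dec p X T \<longleftrightarrow> deterministic p \<and>
     (\<forall>I \<in> X. \<forall>\<omega>. \<exists>t. run p (enc_crossword I) \<omega> t (completely_fillable I) \<and> real t \<le> T I)"

text \<open>
  Solvability in time \<open>2 ^ (\<epsilon> n\<^sup>2) \<cdot> m\<^bsup>O(1)\<^esup>\<close> for \<open>n\<close> slots and \<open>m\<close> words. As usual, factors
  polynomial in the input size are granted to the algorithm as well: even for bounded \<open>n\<close> and \<open>m\<close>, words and slots
  can be arbitrarily long, so that reading the input alone exceeds \<open>2 ^ (\<epsilon> n\<^sup>2) \<cdot> m\<^bsup>O(1)\<^esup>\<close> and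
  unsolvability without such factors would hold trivially. The notion is weaker than the literal
  one, hence its negation stronger.
\<close>

definition CP_Dec_solvable :: "bool crossword set \<Rightarrow> real \<Rightarrow> bool" where
  "CP_Dec_solvable X \<epsilon> \<longleftrightarrow> (\<exists>p C c. solves_CP_Dec p X
     (\<lambda>I. C * 2 powr (\<epsilon> * real (num_slots I) ^ 2) * real (num_words I + input_size I) ^ c))"

end

theory Submission
  imports Defs
begin

text \<open>
  A 3-SAT instance with \<open>m\<close> clauses is turned into a crossword with \<open>O(\<surd>m)\<close> slots and \<open>2\<^bsup>O(\<surd>m)\<^esup>\<close> words.
  The clauses are distributed over \<open>q = \<lceil>\<surd>m\<rceil>\<close> horizontal slots with at most \<open>q\<close> clauses each, and the words
  of such a slot list the values of its variables under the assignments that satisfy its clauses. What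
  remains is to force the slots to agree on common variables. It is enough to do so for any two
  consecutive slots that contain a variable \<open>v\<close>; such a link is realised by a vertical slot whose
  crossings with both are reserved for \<open>v\<close>. Each horizontal slot takes part in at most \<open>6q\<close> links, so
  \<open>12q + 1\<close> vertical slots suffice to place all links greedily, in polynomial time. This placement
  is deterministic, so no random partition of the clauses is needed. Padding the words by different
  amounts makes the slot sizes distinct. On the resulting \<open>s = 13q + 1\<close> slots a solver with running
  time \<open>2^(\<delta>s\<^sup>2)\<close>, up to polynomial factors, decides 3-SAT in time \<open>2\<^bsup>O(\<delta>m + \<surd>N)\<^esup>\<close>, where \<open>N\<close> is the
  number of variables and clauses.
\<close>

subsection \<open>Programs with a time bound\<close>

text \<open>Linking only consecutive occurrences keeps the number of links small: an occurrence of a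
  variable has at most two neighbours, so the at most \<open>3 * q\<close> occurrences in a row
  yield at most \<open>6 * q\<close> link ends. A link needs one column that is still free in both
  of its rows, and these block at most \<open>12 * q\<close> columns, so one more always leaves a
  choice. Linking every two rows that share a variable could give a single row quadratically many
  links in \<open>q\<close>, and the number of slots would no longer be \<open>O(q)\<close>.

  Distinct lengths serve a second purpose: all slots share one dictionary, but the length of a word
  reveals for which slot it was made, so in effect each slot has a dictionary of its own.

  Listing the words is not polynomial in the formula. The cost of the reduction is therefore
  measured against a budget that includes the number of candidate words. This budget enters the
  final bound only with a constant exponent, and half of the allowed \<epsilon> N absorbs it; the
  other half pays for the solver.\<close>

definition runs :: "com \<Rightarrow> store \<Rightarrow> nat \<Rightarrow> store \<Rightarrow> bool" where
  "runs p s T s' \<longleftrightarrow> (\<forall>\<omega> k. \<exists>t\<le>T. exec \<omega> p (s, k) t (s', k))"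

lemma runs_mono: "runs p s T s' \<Longrightarrow> T \<le> T' \<Longrightarrow> runs p s T' s'"
  unfolding runs_def by (meson order_trans)

lemma runs_Assign: "runs (Assign x e) s (1 + expr_cost e) (s(x := eval_expr e s))"
  unfolding runs_def by (blast intro: exec.Assign)

lemma runs_AssignI: "T = 1 + expr_cost e \<Longrightarrow> s' = s(x := eval_expr e s) \<Longrightarrow> runs (Assign x e) s T s'"
  using runs_Assign by simp

lemma runs_Seq: "runs p s T s' \<Longrightarrow> runs q s' T' s'' \<Longrightarrow> runs (Seq p q) s (T + T') s''"
  unfolding runs_def by (meson exec.Seq add_mono)

lemma runs_If:
  assumes "runs (if eval_expr e s \<noteq> NIL then p else q) s T s'"
  shows "runs (If e p q) s (1 + expr_cost e + T) s'"
  unfolding runs_def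
proof (intro allI)
  fix \<omega> k
  obtain t where "t \<le> T" "exec \<omega> (if eval_expr e s \<noteq> NIL then p else q) (s, k) t (s', k)"
    using assms unfolding runs_def by blast
  then show "\<exists>t\<le>1 + expr_cost e + T. exec \<omega> (com.If e p q) (s, k) t (s', k)"
    by (intro exI[of _ "1 + expr_cost e + t"])
       (auto split: if_splits intro: exec.IfTrue[simplified] exec.IfFalse[simplified])
qed

lemma runs_While_False: "eval_expr e s = NIL \<Longrightarrow> runs (While e p) s (1 + expr_cost e) s"
  unfolding runs_def by (blast intro: exec.WhileFalse)

lemma runs_While_True:
  assumes "eval_expr e s \<noteq> NIL" "runs p s T s'" "runs (While e p) s' T' s''"
  shows "runs (While e p) s (1 + expr_cost e + T + T') s''"
  unfolding runs_def
proof (intro allI)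
  fix \<omega> k
  obtain t where t: "t \<le> T" "exec \<omega> p (s, k) t (s', k)"
    using assms(2) unfolding runs_def by blast
  obtain t' where t': "t' \<le> T'" "exec \<omega> (While e p) (s', k) t' (s'', k)"
    using assms(3) unfolding runs_def by blast
  show "\<exists>t\<le>1 + expr_cost e + T + T'. exec \<omega> (While e p) (s, k) t (s'', k)"
    using exec.WhileTrue[OF assms(1) t(2) t'(2)] t(1) t'(1)
    by (intro exI[of _ "1 + expr_cost e + t + t'"]) auto
qed

section \<open>Uniqueness of executions for fixed coins\<close>

inductive_cases exec_AssignE: "exec \<omega> (Assign x e) \<sigma> t \<tau>"
inductive_cases exec_FlipE: "exec \<omega> (Flip x) \<sigma> t \<tau>"
inductive_cases exec_SeqE: "exec \<omega> (Seq c1 c2) \<sigma> t \<tau>"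
inductive_cases exec_IfE: "exec \<omega> (If e c1 c2) \<sigma> t \<tau>"
inductive_cases exec_WhileE: "exec \<omega> (While e c) \<sigma> t \<tau>"

text \<open>Solving 3-SAT demands that every terminating run be correct, while a time bound only
  exhibits one run. Uniqueness closes this gap.\<close>

lemma exec_functional:
  assumes "exec \<omega> c \<sigma> t \<sigma>'" "exec \<omega> c \<sigma> u \<tau>"
  shows "t = u \<and> \<sigma>' = \<tau>"
  using assms
proof (induction arbitrary: u \<tau> rule: exec.induct)
  case (Assign x e s k)
  then show ?case by (elim exec_AssignE) simp
next
  case (Flip x s k)
  then show ?case by (elim exec_FlipE) simp
next
  case (Seq c1 \<sigma>1 t1 \<sigma>2 c2 t2 \<sigma>3)
  obtain u1 \<sigma>' u2 where *: "exec \<omega> c1 \<sigma>1 u1 \<sigma>'" "exec \<omega> c2 \<sigma>' u2 \<tau>" "u = u1 + u2"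
    using Seq.prems by (elim exec_SeqE)
  have "t1 = u1 \<and> \<sigma>2 = \<sigma>'" using Seq.IH(1)[OF *(1)] .
  with Seq.IH(2) * show ?case by blast
next
  case (IfTrue e s c1 k t \<sigma> c2)
  obtain u' where *: "exec \<omega> c1 (s, k) u' \<tau>" "u = 1 + expr_cost e + u'"
    using IfTrue.prems
  proof (rule exec_IfE)
  qed (use IfTrue.hyps(1) in simp_all)
  with IfTrue.IH[OF *(1)] show ?case by simp
next
  case (IfFalse e s c2 k t \<sigma> c1)
  obtain u' where *: "exec \<omega> c2 (s, k) u' \<tau>" "u = 1 + expr_cost e + u'"
    using IfFalse.prems
  proof (rule exec_IfE)
  qed (use IfFalse.hyps(1) in simp_all)
  with IfFalse.IH[OF *(1)] show ?case by simp
next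
  case (WhileFalse e s c k)
  from WhileFalse.prems show ?case
  proof (rule exec_WhileE)
  qed (use WhileFalse.hyps(1) in simp_all)
next
  case (WhileTrue e s c k t1 \<sigma>1 t2 \<sigma>2)
  obtain u1 \<sigma>' u2 where *: "exec \<omega> c (s, k) u1 \<sigma>'" "exec \<omega> (While e c) \<sigma>' u2 \<tau>"
      "u = 1 + expr_cost e + u1 + u2"
    using WhileTrue.prems
  proof (rule exec_WhileE)
  qed (use WhileTrue.hyps(1) in simp_all)
  have "t1 = u1 \<and> \<sigma>1 = \<sigma>'" using WhileTrue.IH(1)[OF *(1)] .
  with WhileTrue.IH(2) * show ?case by blast
qed

subsection \<open>Polynomial bounds\<close>

text \<open>The base is at least \<open>2\<close>, so that constants and sums are absorbed into the exponent.\<close>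

definition polybd :: "('x \<Rightarrow> nat) \<Rightarrow> ('x \<Rightarrow> nat) \<Rightarrow> bool" where
  "polybd B T \<longleftrightarrow> (\<exists>c. \<forall>x. T x \<le> (B x + 2) ^ c)"

lemma polybd_mono: "polybd B T \<Longrightarrow> (\<And>x. T' x \<le> T x) \<Longrightarrow> polybd B T'"
  unfolding polybd_def by (meson order_trans)

lemma polybd_self: "polybd B B"
  unfolding polybd_def by (rule exI[of _ 1]) simp

lemma polybd_const: "polybd B (\<lambda>_. k)"
  unfolding polybd_def
proof (intro exI allI)
  fix x
  have "k \<le> 2 ^ k" by (simp add: less_imp_le)
  also have "\<dots> \<le> (B x + 2) ^ k" by (simp add: power_mono)
  finally show "k \<le> (B x + 2) ^ k" .
qed

lemma polybd_mult:
  assumes "polybd B S" "polybd B T"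
  shows "polybd B (\<lambda>x. S x * T x)"
proof -
  obtain c d where "\<forall>x. S x \<le> (B x + 2) ^ c" "\<forall>x. T x \<le> (B x + 2) ^ d"
    using assms unfolding polybd_def by blast
  then have "\<forall>x. S x * T x \<le> (B x + 2) ^ (c + d)"
    by (simp add: power_add mult_mono)
  then show ?thesis unfolding polybd_def by blast
qed

lemma polybd_add:
  assumes "polybd B S" "polybd B T"
  shows "polybd B (\<lambda>x. S x + T x)"
proof -
  \<comment> \<open>Sums reduce to products by \<open>a + b \<le> (a + 1) * (b + 1)\<close>; adding
    \<open>1\<close> costs one more factor of the base, which is at least \<open>2\<close>.\<close>
  have "polybd B (\<lambda>x. (S x + 1) * (T x + 1))" if "polybd B (\<lambda>x. S x + 1)" "polybd B (\<lambda>x. T x + 1)"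
    using that by (rule polybd_mult)
  moreover have "polybd B (\<lambda>x. U x + 1)" if U: "polybd B U" for U
  proof -
    obtain c where c: "\<forall>x. U x \<le> (B x + 2) ^ c" using U unfolding polybd_def by blast
    have "U x + 1 \<le> (B x + 2) ^ Suc c" for x
    proof -
      have "1 \<le> (B x + 2) ^ c" by simp
      then have "U x + 1 \<le> 2 * (B x + 2) ^ c" using c[rule_format, of x] by linarith
      also have "\<dots> \<le> (B x + 2) * (B x + 2) ^ c" by (intro mult_right_mono) auto
      finally show ?thesis by simp
    qed
    then show ?thesis unfolding polybd_def by blast
  qed
  ultimately have "polybd B (\<lambda>x. (S x + 1) * (T x + 1))" using assms by blast
  then show ?thesis by (rule polybd_mono) (simp add: algebra_simps)
qed

lemma polybd_power: "polybd B T \<Longrightarrow> polybd B (\<lambda>x. T x ^ k)"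
  by (induction k) (auto intro: polybd_const polybd_mult)

lemma polybd_trans:
  assumes "polybd S T" "polybd B (\<lambda>x. S (g x))"
  shows "polybd B (\<lambda>x. T (g x))"
proof -
  obtain c where c: "\<forall>x. T x \<le> (S x + 2) ^ c" using assms(1) unfolding polybd_def by blast
  have "polybd B (\<lambda>x. (S (g x) + 2) ^ c)"
    by (intro polybd_power polybd_add polybd_const assms(2))
  then show ?thesis by (rule polybd_mono) (rule c[rule_format])
qed

lemma polybd_Suc: "polybd B T \<Longrightarrow> polybd B (\<lambda>x. Suc (T x))"
  using polybd_add[of B T "\<lambda>_. 1"] polybd_const[of B 1] by simp

lemmas polybd_intros = polybd_self polybd_const polybd_add polybd_mult polybd_Suc polybd_power

subsection \<open>Functions computable in polynomial time\<close>

text \<open>Programs may rely on \<open>NIL\<close> in their scratch variables. Variable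
  \<open>0\<close> is exempt because it carries the input. Since every program restores its scratch
  variables, cleanness survives sequential composition.\<close>

definition clean :: "nat \<Rightarrow> store \<Rightarrow> bool" where
  "clean N s \<longleftrightarrow> (\<forall>i. 0 < i \<and> i < N \<longrightarrow> s i = NIL)"

lemma clean_mono: "clean N s \<Longrightarrow> M \<le> N \<Longrightarrow> clean M s"
  unfolding clean_def by auto

lemma clean_upd0 [simp]: "clean N (s(0 := d)) \<longleftrightarrow> clean N s"
  unfolding clean_def by auto

lemma clean_upd [simp]: "M \<le> N \<Longrightarrow> clean M (s(N := d)) \<longleftrightarrow> clean M s"
  unfolding clean_def by auto

text \<open>
  A program for \<open>f\<close> leaves every variable but \<open>0\<close> unchanged, so that programs can be combined
  without renaming variables: those from \<open>N\<close> on are free for saving intermediate results.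
\<close>

definition computes ::
  "com \<Rightarrow> nat \<Rightarrow> ('x \<Rightarrow> nat) \<Rightarrow> ('x \<Rightarrow> data) \<Rightarrow> ('y \<Rightarrow> data) \<Rightarrow> ('x \<Rightarrow> 'y) \<Rightarrow> bool" where
  "computes p N T e b f \<longleftrightarrow> deterministic p \<and>
     (\<forall>s x. s 0 = e x \<longrightarrow> clean N s \<longrightarrow> runs p s (T x) (s(0 := b (f x))))"

text \<open>The budget \<open>B\<close> is separate from the input size because listing all words of
  a given length is polynomial only relative to a quantity that includes their number. The two size
  conditions make the notion closed under composition.\<close>

definition ptime_in :: "('x \<Rightarrow> nat) \<Rightarrow> ('x \<Rightarrow> data) \<Rightarrow> ('y \<Rightarrow> data) \<Rightarrow> ('x \<Rightarrow> 'y) \<Rightarrow> bool" where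
  "ptime_in B e b f \<longleftrightarrow> polybd B (\<lambda>x. data_size (e x)) \<and> polybd B (\<lambda>x. data_size (b (f x))) \<and>
     (\<exists>p N T. computes p N T e b f \<and> polybd B T)"

abbreviation ptime :: "('x \<Rightarrow> data) \<Rightarrow> ('y \<Rightarrow> data) \<Rightarrow> ('x \<Rightarrow> 'y) \<Rightarrow> bool" where
  "ptime e b f \<equiv> ptime_in (\<lambda>x. data_size (e x)) e b f"

lemma ptime_inI:
  "polybd B (\<lambda>x. data_size (e x)) \<Longrightarrow> polybd B (\<lambda>x. data_size (b (f x))) \<Longrightarrow>
   computes p N T e b f \<Longrightarrow> polybd B T \<Longrightarrow> ptime_in B e b f"
  unfolding ptime_in_def by blast

lemma ptime_inE:
  assumes "ptime_in B e b f"
  obtains p N T where "polybd B (\<lambda>x. data_size (e x))" "polybd B (\<lambda>x. data_size (b (f x)))"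
    "computes p N T e b f" "polybd B T"
  using assms unfolding ptime_in_def by blast

lemma ptime_in_size: "ptime_in B e b f \<Longrightarrow> polybd B (\<lambda>x. data_size (e x))"
  by (rule ptime_inE)

lemma computesD:
  "computes p N T e b f \<Longrightarrow> s 0 = e x \<Longrightarrow> clean N s \<Longrightarrow> runs p s (T x) (s(0 := b (f x)))"
  unfolding computes_def by blast

section \<open>Composition, pairing, branching and iteration\<close>

text \<open>The second function is polynomial in its own input, whose size is polynomial in
  \<open>B\<close> by the size condition on the first. Hence only the first function may need a
  budget beyond its input.\<close>

lemma ptime_in_comp:
  assumes "ptime_in B e b f" "ptime b d g"
  shows "ptime_in B e d (\<lambda>x. g (f x))"
proof -
  obtain p N T where p: "polybd B (\<lambda>x. data_size (e x))" "polybd B (\<lambda>x. data_size (b (f x)))"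
    "computes p N T e b f" "polybd B T"
    using assms(1) by (rule ptime_inE)
  obtain p' N' T' where p': "polybd (\<lambda>x. data_size (b x)) (\<lambda>x. data_size (d (g x)))"
    "computes p' N' T' b d g" "polybd (\<lambda>x. data_size (b x)) T'"
    using assms(2) by (elim ptime_inE)
  have "computes (Seq p p') (max N N') (\<lambda>x. T x + T' (f x)) e d (\<lambda>x. g (f x))"
    unfolding computes_def
  proof (intro conjI allI impI)
    show "deterministic (Seq p p')" using p(3) p'(2) by (simp add: computes_def)
    fix s x assume s: "s 0 = e x" "clean (max N N') s"
    have 1: "runs p s (T x) (s(0 := b (f x)))"
      using computesD[OF p(3), of s x] s clean_mono[OF s(2), of N] by simp
    have "runs p' (s(0 := b (f x))) (T' (f x)) (s(0 := b (f x), 0 := d (g (f x))))"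
      by (rule computesD[OF p'(2)]) (use clean_mono[OF s(2), of N'] in simp_all)
    from runs_Seq[OF 1 this] show "runs (Seq p p') s (T x + T' (f x)) (s(0 := d (g (f x))))"
      by simp
  qed
  moreover have "polybd B (\<lambda>x. data_size (d (g (f x))))"
    using p'(1) p(2) by (rule polybd_trans)
  moreover have "polybd B (\<lambda>x. T x + T' (f x))"
    using polybd_trans[OF p'(3) p(2)] by (intro polybd_add p(4))
  ultimately show ?thesis by (intro ptime_inI[OF p(1)])
qed

lemma ptime_expr:
  assumes eval: "\<And>(s :: store) x. s 0 = e x \<Longrightarrow> eval_expr E s = b (f x)"
    and sz: "polybd (\<lambda>x. data_size (e x)) (\<lambda>x. data_size (b (f x)))"
  shows "ptime e b f"
proof (rule ptime_inI)
  show "polybd (\<lambda>x. data_size (e x)) (\<lambda>x. data_size (e x))" by (rule polybd_self)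
  show "polybd (\<lambda>x. data_size (e x)) (\<lambda>x. data_size (b (f x)))" by (rule sz)
  show "computes (Assign 0 E) 0 (\<lambda>_. 1 + expr_cost E) e b f"
    unfolding computes_def
  proof (intro conjI allI impI)
    fix s :: store and x assume "s 0 = e x"
    then have "s(0 := b (f x)) = s(0 := eval_expr E s)" using eval by simp
    then show "runs (Assign 0 E) s (1 + expr_cost E) (s(0 := b (f x)))"
      by (simp only: runs_Assign)
  qed simp
qed (rule polybd_const)

lemma ptime_id: "ptime e e (\<lambda>x. x)"
  by (rule ptime_expr[of _ "EVar 0"]) (auto intro: polybd_self)

lemma ptime_in_id: "polybd B (\<lambda>x. data_size (e x)) \<Longrightarrow> ptime_in B e e (\<lambda>x. x)"
proof -
  assume B: "polybd B (\<lambda>x. data_size (e x))"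
  obtain p N T where p: "computes p N T e e (\<lambda>x. x)" "polybd (\<lambda>x. data_size (e x)) T"
    using ptime_id[of e] by (elim ptime_inE)
  show "ptime_in B e e (\<lambda>x. x)"
    by (rule ptime_inI[OF B B p(1) polybd_trans[OF p(2) B]])
qed

definition enc_pair :: "('a \<Rightarrow> data) \<Rightarrow> ('b \<Rightarrow> data) \<Rightarrow> 'a \<times> 'b \<Rightarrow> data" where
  "enc_pair a b = (\<lambda>(x, y). CONS (a x) (b y))"

lemma enc_pair_simp [simp]: "enc_pair a b (x, y) = CONS (a x) (b y)"
  by (simp add: enc_pair_def)

lemma ptime_in_pair:
  assumes "ptime_in B e a f" "ptime_in B e b g"
  shows "ptime_in B e (enc_pair a b) (\<lambda>x. (f x, g x))"
proof -
  obtain p N T where p: "polybd B (\<lambda>x. data_size (e x))" "polybd B (\<lambda>x. data_size (a (f x)))"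
    "computes p N T e a f" "polybd B T"
    using assms(1) by (rule ptime_inE)
  obtain p' N' T' where p': "polybd B (\<lambda>x. data_size (b (g x)))"
    "computes p' N' T' e b g" "polybd B T'"
    using assms(2) by (elim ptime_inE)
  \<comment> \<open>Both programs change only variable \<open>0\<close> and need \<open>NIL\<close>
    only below \<open>M\<close>. So \<open>M\<close> can keep the input and \<open>Suc M\<close> the
    first result; both are reset at the end to restore the store.\<close>
  define M where "M = Suc (max N N')"
  have M: "N \<le> M" "N' \<le> M" "0 < M" unfolding M_def by auto
  let ?P = "Seq (Assign M (EVar 0)) (Seq p (Seq (Assign (Suc M) (EVar 0)) (Seq (Assign 0 (EVar M))
    (Seq p' (Seq (Assign 0 (ECons (EVar (Suc M)) (EVar 0)))
    (Seq (Assign M ENil) (Assign (Suc M) ENil)))))))"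
  have "computes ?P (Suc (Suc M)) (\<lambda>x. T x + T' x + 14) e (enc_pair a b) (\<lambda>x. (f x, g x))"
    unfolding computes_def
  proof (intro conjI allI impI)
    show "deterministic ?P" using p(3) p'(2) by (simp add: computes_def)
    fix s x assume s: "s 0 = e x" "clean (Suc (Suc M)) s"
    have s': "clean N s" "clean N' s" "s M = NIL" "s (Suc M) = NIL"
      using s(2) M unfolding clean_def by auto
    define s1 where "s1 = s(M := e x)"
    define s2 where "s2 = s1(0 := a (f x))"
    define s3 where "s3 = s2(Suc M := a (f x))"
    define s4 where "s4 = s3(0 := e x)"
    define s5 where "s5 = s4(0 := b (g x))"
    define s6 where "s6 = s5(0 := CONS (a (f x)) (b (g x)))"
    define s7 where "s7 = s6(M := NIL)"
    note defs = s1_def s2_def s3_def s4_def s5_def s6_def s7_def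
    have r1: "runs (Assign M (EVar 0)) s 2 s1"
      by (rule runs_AssignI) (use s(1) in \<open>simp_all add: defs\<close>)
    have r2: "runs p s1 (T x) s2"
      unfolding s2_def by (rule computesD[OF p(3)]) (use s s' M in \<open>auto simp: defs\<close>)
    have r3: "runs (Assign (Suc M) (EVar 0)) s2 2 s3"
      by (rule runs_AssignI) (simp_all add: defs)
    have r4: "runs (Assign 0 (EVar M)) s3 2 s4"
      by (rule runs_AssignI) (use M in \<open>simp_all add: defs\<close>)
    have r5: "runs p' s4 (T' x) s5"
      unfolding s5_def by (rule computesD[OF p'(2)]) (use s s' M in \<open>auto simp: defs\<close>)
    have r6: "runs (Assign 0 (ECons (EVar (Suc M)) (EVar 0))) s5 4 s6"
      by (rule runs_AssignI) (simp_all add: defs)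
    have r7: "runs (Assign M ENil) s6 2 s7"
      by (rule runs_AssignI) (simp_all add: defs)
    have r8: "runs (Assign (Suc M) ENil) s7 2 (s7(Suc M := NIL))"
      by (rule runs_AssignI) (simp_all)
    have eq: "s7(Suc M := NIL) = s(0 := enc_pair a b (f x, g x))"
      using s' M by (auto simp: defs fun_eq_iff)
    note runs_Seq[OF r1 runs_Seq[OF r2 runs_Seq[OF r3 runs_Seq[OF r4 runs_Seq[OF r5
      runs_Seq[OF r6 runs_Seq[OF r7 r8]]]]]]]
    then show "runs ?P s (T x + T' x + 14) (s(0 := enc_pair a b (f x, g x)))"
      unfolding eq by (rule runs_mono) simp
  qed
  moreover have "polybd B (\<lambda>x. T x + T' x + 14)"
    by (intro polybd_intros p(4) p'(3))
  moreover have "polybd B (\<lambda>x. data_size (enc_pair a b (f x, g x)))"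
    by (simp, intro polybd_intros p(2) p'(1))
  ultimately show ?thesis by (intro ptime_inI[OF p(1)])
qed

lemma ptime_in_If:
  assumes c: "ptime_in B e enc_bool c" and f: "ptime_in B e b f" and g: "ptime_in B e b g"
  shows "ptime_in B e b (\<lambda>x. if c x then f x else g x)"
proof -
  obtain p N T where p: "polybd B (\<lambda>x. data_size (e x))"
    "computes p N T e (enc_pair enc_bool e) (\<lambda>x. (c x, x))" "polybd B T"
    \<comment> \<open>Pairing the condition with the input lets either branch recover the input from
      the tail of variable \<open>0\<close>, without a scratch variable.\<close>
    using ptime_in_pair[OF c ptime_in_id[OF ptime_in_size[OF c]]] by (elim ptime_inE)
  obtain p1 N1 T1 where p1: "polybd B (\<lambda>x. data_size (b (f x)))"
    "computes p1 N1 T1 e b f" "polybd B T1"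
    using f by (elim ptime_inE)
  obtain p2 N2 T2 where p2: "polybd B (\<lambda>x. data_size (b (g x)))"
    "computes p2 N2 T2 e b g" "polybd B T2"
    using g by (elim ptime_inE)
  let ?R = "Seq (Assign 0 (ETl (EVar 0)))"
  let ?P = "Seq p (If (EHd (EVar 0)) (?R p1) (?R p2))"
  have "computes ?P (max N (max N1 N2)) (\<lambda>x. T x + T1 x + T2 x + 6) e b
    (\<lambda>x. if c x then f x else g x)"
    unfolding computes_def
  proof (intro conjI allI impI)
    show "deterministic ?P" using p p1 p2 by (simp add: computes_def)
    fix s x assume s: "s 0 = e x" "clean (max N (max N1 N2)) s"
    then have s': "clean N s" "clean N1 s" "clean N2 s" by (auto intro: clean_mono)
    define s1 where "s1 = s(0 := CONS (enc_bool (c x)) (e x))"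
    have r1: "runs p s (T x) s1"
      using computesD[OF p(2), of s x] s(1) s'(1) by (simp add: s1_def)
    have r2: "runs (Assign 0 (ETl (EVar 0))) s1 3 (s1(0 := e x))"
      by (rule runs_AssignI) (simp_all add: s1_def)
    have r3: "runs p1 (s1(0 := e x)) (T1 x) (s1(0 := e x, 0 := b (f x)))"
      by (rule computesD[OF p1(2)]) (use s' in \<open>auto simp: s1_def\<close>)
    have r4: "runs p2 (s1(0 := e x)) (T2 x) (s1(0 := e x, 0 := b (g x)))"
      by (rule computesD[OF p2(2)]) (use s' in \<open>auto simp: s1_def\<close>)
    have r5: "runs (if eval_expr (EHd (EVar 0)) s1 \<noteq> NIL then ?R p1 else ?R p2) s1
       (3 + (T1 x + T2 x)) (s(0 := b (if c x then f x else g x)))"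
      using runs_mono[OF runs_Seq[OF r2 r3], of "3 + (T1 x + T2 x)"]
        runs_mono[OF runs_Seq[OF r2 r4], of "3 + (T1 x + T2 x)"]
      by (cases "c x") (simp_all add: s1_def)
    from runs_Seq[OF r1 runs_If[OF r5]]
    show "runs ?P s (T x + T1 x + T2 x + 6) (s(0 := b (if c x then f x else g x)))"
      by (rule runs_mono) simp
  qed
  moreover have "polybd B (\<lambda>x. T x + T1 x + T2 x + 6)"
    by (intro polybd_intros p p1 p2)
  moreover have "polybd B (\<lambda>x. data_size (b (if c x then f x else g x)))"
    by (rule polybd_mono[OF polybd_add[OF p1(1) p2(1)]]) simp
  ultimately show ?thesis by (intro ptime_inI[OF p(1)])
qed

lemma length_le_data_size: "length xs \<le> data_size (enc_list a xs)"
  by (induction xs) auto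

lemma ptime_in_case_list:
  assumes l: "ptime_in B e (enc_list a) l" and f: "ptime_in B e b f"
    and g: "ptime (enc_pair a (enc_pair (enc_list a) e)) b (\<lambda>z. g (snd (snd z)) (fst z) (fst (snd z)))"
  shows "ptime_in B e b (\<lambda>x. case l x of [] \<Rightarrow> f x | y # ys \<Rightarrow> g x y ys)"
proof -
  obtain p N T where p: "polybd B (\<lambda>x. data_size (e x))"
    "computes p N T e (enc_pair (enc_list a) e) (\<lambda>x. (l x, x))" "polybd B T"
    using ptime_in_pair[OF l ptime_in_id[OF ptime_in_size[OF l]]] by (elim ptime_inE)
  have l': "polybd B (\<lambda>x. data_size (enc_list a (l x)))"
    using l by (elim ptime_inE)
  obtain p1 N1 T1 where p1: "polybd B (\<lambda>x. data_size (b (f x)))"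
    "computes p1 N1 T1 e b f" "polybd B T1"
    using f by (elim ptime_inE)
  let ?E = "enc_pair a (enc_pair (enc_list a) e)"
  obtain p2 N2 T2 where p2:
    "polybd (\<lambda>z. data_size (?E z)) (\<lambda>z. data_size (b (g (snd (snd z)) (fst z) (fst (snd z)))))"
    "computes p2 N2 T2 ?E b (\<lambda>z. g (snd (snd z)) (fst z) (fst (snd z)))"
    "polybd (\<lambda>z. data_size (?E z)) T2"
    using g by (elim ptime_inE)
  obtain c where c: "\<forall>z. data_size (b (g (snd (snd z)) (fst z) (fst (snd z)))) \<le> (data_size (?E z) + 2) ^ c"
    "\<forall>z. T2 z \<le> (data_size (?E z) + 2) ^ c"
  proof -
    obtain c1 c2 where
      1: "\<forall>z. data_size (b (g (snd (snd z)) (fst z) (fst (snd z)))) \<le> (data_size (?E z) + 2) ^ c1"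
      and 2: "\<forall>z. T2 z \<le> (data_size (?E z) + 2) ^ c2"
      using p2(1,3) unfolding polybd_def by blast
    have "(data_size (?E z) + 2) ^ c1 \<le> (data_size (?E z) + 2) ^ max c1 c2"
      "(data_size (?E z) + 2) ^ c2 \<le> (data_size (?E z) + 2) ^ max c1 c2" for z
      by (auto intro!: power_increasing)
    with 1 2 have "\<forall>z. data_size (b (g (snd (snd z)) (fst z) (fst (snd z)))) \<le> (data_size (?E z) + 2) ^ max c1 c2"
      "\<forall>z. T2 z \<le> (data_size (?E z) + 2) ^ max c1 c2"
      by (meson order_trans)+
    then show thesis by (rule that)
  qed
  \<comment> \<open>The branch program is measured against the triple of head, tail and input.
    \<open>U\<close> turns this into a bound in \<open>x\<close> alone: apart from constant nodes,
    the triple is \<open>l x\<close> paired with the input.\<close>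
  define U where "U x = (data_size (enc_list a (l x)) + data_size (e x) + 3) ^ c" for x
  have U: "polybd B U" unfolding U_def by (intro polybd_intros l' p(1))
  have bd: "data_size (b (g x y ys)) \<le> U x \<and> T2 (y, ys, x) \<le> U x" if "l x = y # ys" for x y ys
  proof -
    have "(data_size (?E (y, ys, x)) + 2) ^ c \<le> U x"
      unfolding U_def by (rule power_mono) (use that in auto)
    then show ?thesis using c[rule_format, of "(y, ys, x)"] by simp
  qed
  let ?Q = "Seq (Assign 0 (ECons (EHd (EHd (EVar 0))) (ECons (ETl (EHd (EVar 0))) (ETl (EVar 0))))) p2"
  let ?R = "Seq (Assign 0 (ETl (EVar 0))) p1"
  let ?P = "Seq p (If (EHd (EVar 0)) ?Q ?R)"
  have "computes ?P (max N (max N1 N2)) (\<lambda>x. T x + T1 x + U x + 17) e b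
    (\<lambda>x. case l x of [] \<Rightarrow> f x | y # ys \<Rightarrow> g x y ys)"
    unfolding computes_def
  proof (intro conjI allI impI)
    show "deterministic ?P" using p p1 p2 by (simp add: computes_def)
    fix s x assume s: "s 0 = e x" "clean (max N (max N1 N2)) s"
    then have s': "clean N s" "clean N1 s" "clean N2 s" by (auto intro: clean_mono)
    define s1 where "s1 = s(0 := CONS (enc_list a (l x)) (e x))"
    have r1: "runs p s (T x) s1"
      using computesD[OF p(2), of s x] s(1) s'(1) by (simp add: s1_def)
    show "runs ?P s (T x + T1 x + U x + 17) (s(0 := b (case l x of [] \<Rightarrow> f x | y # ys \<Rightarrow> g x y ys)))"
    proof (cases "l x")
      case Nil
      have r2: "runs (Assign 0 (ETl (EVar 0))) s1 3 (s1(0 := e x))"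
        by (rule runs_AssignI) (simp_all add: s1_def)
      have r3: "runs p1 (s1(0 := e x)) (T1 x) (s1(0 := e x, 0 := b (f x)))"
        by (rule computesD[OF p1(2)]) (use s' in \<open>auto simp: s1_def\<close>)
      have "eval_expr (EHd (EVar 0)) s1 = NIL" using Nil by (simp add: s1_def)
      then have "runs (If (EHd (EVar 0)) ?Q ?R) s1 (1 + expr_cost (EHd (EVar 0)) + (3 + T1 x)) (s1(0 := e x, 0 := b (f x)))"
        using runs_Seq[OF r2 r3] by (intro runs_If) simp
      note runs_Seq[OF r1 this]
      moreover have "s1(0 := e x, 0 := b (f x)) = s(0 := b (case l x of [] \<Rightarrow> f x | y # ys \<Rightarrow> g x y ys))"
        using Nil by (simp add: s1_def)
      ultimately show ?thesis by (simp only:) (erule runs_mono, simp)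
    next
      case (Cons y ys)
      let ?A = "ECons (EHd (EHd (EVar 0))) (ECons (ETl (EHd (EVar 0))) (ETl (EVar 0)))"
      have r2: "runs (Assign 0 ?A) s1 11 (s1(0 := ?E (y, ys, x)))"
        by (rule runs_AssignI) (use Cons in \<open>simp_all add: s1_def\<close>)
      have r3: "runs p2 (s1(0 := ?E (y, ys, x))) (T2 (y, ys, x)) (s1(0 := ?E (y, ys, x), 0 := b (g x y ys)))"
        using computesD[OF p2(2), of "s1(0 := ?E (y, ys, x))" "(y, ys, x)"] s'
        by (auto simp: s1_def)
      have "eval_expr (EHd (EVar 0)) s1 \<noteq> NIL" using Cons by (simp add: s1_def)
      then have "runs (If (EHd (EVar 0)) ?Q ?R) s1 (1 + expr_cost (EHd (EVar 0)) + (11 + T2 (y, ys, x)))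
          (s1(0 := ?E (y, ys, x), 0 := b (g x y ys)))"
        using runs_Seq[OF r2 r3] by (intro runs_If) simp
      note runs_Seq[OF r1 this]
      moreover have "s1(0 := ?E (y, ys, x), 0 := b (g x y ys)) = s(0 := b (case l x of [] \<Rightarrow> f x | y # ys \<Rightarrow> g x y ys))"
        using Cons by (simp add: s1_def)
      ultimately show ?thesis
        using bd[OF Cons] by (simp only:) (erule runs_mono, simp)
    qed
  qed
  moreover have "polybd B (\<lambda>x. T x + T1 x + U x + 17)"
    by (intro polybd_intros p p1 U)
  moreover have "polybd B (\<lambda>x. data_size (b (case l x of [] \<Rightarrow> f x | y # ys \<Rightarrow> g x y ys)))"
  proof (rule polybd_mono[OF polybd_add[OF p1(1) U]])
    show "data_size (b (case l x of [] \<Rightarrow> f x | y # ys \<Rightarrow> g x y ys)) \<le> data_size (b (f x)) + U x" for x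
      using bd by (cases "l x") (simp_all add: trans_le_add2)
  qed
  ultimately show ?thesis by (intro ptime_inI[OF p(1)])
qed

text \<open>Iterating a polynomial time step may blow up the accumulator exponentially, for instance
  by doubling it. A bound \<open>S\<close> on the accumulator after every prefix has to be supplied;
  it bounds the time of each step as well.\<close>

lemma ptime_in_foldl:
  assumes l: "ptime_in B e (enc_list a) l" and i: "ptime_in B e b i"
    and g: "ptime (enc_pair a (enc_pair b e)) b (\<lambda>z. g (snd (snd z)) (fst (snd z)) (fst z))"
    and S: "polybd B S" "\<And>x n. data_size (b (foldl (g x) (i x) (take n (l x)))) \<le> S x"
  shows "ptime_in B e b (\<lambda>x. foldl (g x) (i x) (l x))"
proof -
  have e': "polybd B (\<lambda>x. data_size (e x))"
    using l by (rule ptime_in_size)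
  have l': "polybd B (\<lambda>x. data_size (enc_list a (l x)))"
    using l by (elim ptime_inE)
  obtain p N T where p:
    "computes p N T e (enc_pair (enc_list a) (enc_pair b e)) (\<lambda>x. (l x, i x, x))" "polybd B T"
    using ptime_in_pair[OF l ptime_in_pair[OF i ptime_in_id[OF e']]] by (elim ptime_inE)
  let ?E = "enc_pair a (enc_pair b e)"
  obtain p2 N2 T2 where p2:
    "computes p2 N2 T2 ?E b (\<lambda>z. g (snd (snd z)) (fst (snd z)) (fst z))"
    "polybd (\<lambda>z. data_size (?E z)) T2"
    using g by (elim ptime_inE)
  obtain c where c: "\<forall>z. T2 z \<le> (data_size (?E z) + 2) ^ c"
    using p2(2) unfolding polybd_def by blast
  define U where "U x = (data_size (enc_list a (l x)) + S x + data_size (e x) + 4) ^ c" for x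
  define M where "M = Suc (max N N2)"
  have M: "N \<le> M" "N2 \<le> M" "0 < M" unfolding M_def by auto
  let ?A = "ECons (EHd (EHd (EVar 0))) (ETl (EVar 0))"
  let ?C = "ECons (ETl (EHd (EVar M))) (ECons (EVar 0) (ETl (ETl (EVar M))))"
  let ?L = "Seq (Assign M (EVar 0)) (Seq (Assign 0 ?A) (Seq p2 (Seq (Assign 0 ?C) (Assign M ENil))))"
  let ?W = "While (EHd (EVar 0)) ?L"
  let ?P = "Seq p (Seq ?W (Assign 0 (EHd (ETl (EVar 0)))))"
  \<comment> \<open>Between iterations variable \<open>0\<close> holds the remaining list, the
    accumulator and the input, and \<open>M\<close> is \<open>NIL\<close>. The prefix
    \<open>zs\<close> already consumed is tracked only to apply the bound \<open>S\<close> to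
    \<open>acc\<close>.\<close>
  have loop: "runs ?W (s(0 := CONS (enc_list a ys) (CONS (b acc) (e x)))) (3 + length ys * (U x + 30))
      (s(0 := CONS NIL (CONS (b (foldl (g x) acc ys)) (e x))))"
    if "clean (Suc M) s" "l x = zs @ ys" "acc = foldl (g x) (i x) zs" for s x zs ys acc
    using that(2,3)
  proof (induction ys arbitrary: acc zs)
    case Nil
    show ?case
      unfolding foldl_Nil enc_list.simps
      by (rule runs_mono[OF runs_While_False]) simp_all
  next
    case (Cons y ys)
    let ?v = "CONS (enc_list a (y # ys)) (CONS (b acc) (e x))"
    define s1 where "s1 = s(0 := ?v)"
    define s2 where "s2 = s1(M := ?v)"
    define s3 where "s3 = s2(0 := ?E (y, acc, x))"
    define s4 where "s4 = s3(0 := b (g x acc y))"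
    define s5 where "s5 = s4(0 := CONS (enc_list a ys) (CONS (b (g x acc y)) (e x)))"
    note defs = s1_def s2_def s3_def s4_def s5_def
    have sM: "s M = NIL" "clean N2 s"
      using that(1) M unfolding clean_def by auto
    have r1: "runs (Assign M (EVar 0)) s1 2 s2"
      by (rule runs_AssignI) (simp_all add: defs)
    have r2: "runs (Assign 0 ?A) s2 7 s3"
      by (rule runs_AssignI) (use M in \<open>simp_all add: defs\<close>)
    have "length zs \<le> length (l x)" "take (length zs) (l x) = zs"
      using Cons.prems(1) by auto
    then have acc: "data_size (b acc) \<le> S x"
      using S(2)[of x "length zs"] Cons.prems(2) by simp
    have yl: "data_size (a y) \<le> data_size (enc_list a (l x))"
      unfolding Cons.prems(1) by (induction zs) auto
    have "T2 (y, acc, x) \<le> (data_size (?E (y, acc, x)) + 2) ^ c" using c by blast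
    also have "\<dots> \<le> U x" unfolding U_def
      by (rule power_mono) (use yl acc in auto)
    finally have T2: "T2 (y, acc, x) \<le> U x" .
    have r3: "runs p2 s3 (U x) s4"
      using computesD[OF p2(1), of s3 "(y, acc, x)"] sM M runs_mono[OF _ T2]
      by (simp add: defs)
    have r4: "runs (Assign 0 ?C) s4 10 s5"
      by (rule runs_AssignI) (use M in \<open>simp_all add: defs\<close>)
    have "s5(M := NIL) = s(0 := CONS (enc_list a ys) (CONS (b (g x acc y)) (e x)))"
      using sM M by (auto simp: defs fun_eq_iff)
    then have r5: "runs (Assign M ENil) s5 (1 + 1) (s(0 := CONS (enc_list a ys) (CONS (b (g x acc y)) (e x))))"
      using runs_Assign[of M ENil s5] by simp
    note body = runs_Seq[OF r1 runs_Seq[OF r2 runs_Seq[OF r3 runs_Seq[OF r4 r5]]]]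
    have IH: "runs ?W (s(0 := CONS (enc_list a ys) (CONS (b (g x acc y)) (e x))))
      (3 + length ys * (U x + 30))
      (s(0 := CONS NIL (CONS (b (foldl (g x) (g x acc y) ys)) (e x))))"
      by (rule Cons.IH[of "zs @ [y]"]) (use Cons.prems in auto)
    have nz: "eval_expr (EHd (EVar 0)) s1 \<noteq> NIL" by (simp add: defs)
    show ?case
      unfolding s1_def[symmetric] foldl_Cons
      by (rule runs_mono[OF runs_While_True[OF nz body IH]]) simp
  qed
  have "computes ?P (Suc M) (\<lambda>x. T x + (7 + data_size (enc_list a (l x)) * (U x + 30))) e b
    (\<lambda>x. foldl (g x) (i x) (l x))"
    unfolding computes_def
  proof (intro conjI allI impI)
    show "deterministic ?P" using p p2 by (simp add: computes_def)
    fix s x assume s: "s 0 = e x" "clean (Suc M) s"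
    have r1: "runs p s (T x) (s(0 := CONS (enc_list a (l x)) (CONS (b (i x)) (e x))))"
      using computesD[OF p(1), of s x] s M clean_mono[OF s(2), of N] by simp
    have r2: "runs ?W (s(0 := CONS (enc_list a (l x)) (CONS (b (i x)) (e x)))) (3 + length (l x) * (U x + 30))
      (s(0 := CONS NIL (CONS (b (foldl (g x) (i x) (l x))) (e x))))"
      by (rule loop[OF s(2), of x "[]"]) auto
    let ?s = "s(0 := CONS NIL (CONS (b (foldl (g x) (i x) (l x))) (e x)))"
    have r3: "runs (Assign 0 (EHd (ETl (EVar 0)))) ?s 4 (s(0 := b (foldl (g x) (i x) (l x))))"
      by (rule runs_AssignI) (simp_all)
    have "length (l x) * (U x + 30) \<le> data_size (enc_list a (l x)) * (U x + 30)"
      using length_le_data_size by (intro mult_right_mono) auto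
    then show "runs ?P s (T x + (7 + data_size (enc_list a (l x)) * (U x + 30))) (s(0 := b (foldl (g x) (i x) (l x))))"
      by (intro runs_mono[OF runs_Seq[OF r1 runs_Seq[OF r2 r3]]]) simp
  qed
  moreover have "polybd B (\<lambda>x. T x + (7 + data_size (enc_list a (l x)) * (U x + 30)))"
    unfolding U_def by (intro polybd_intros p e' l' S)
  moreover have "polybd B (\<lambda>x. data_size (b (foldl (g x) (i x) (l x))))"
    by (rule polybd_mono[OF S(1)]) (metis S(2) take_all order_refl)
  ultimately show ?thesis by (intro ptime_inI[OF e'])
qed

subsection \<open>A library of polynomial time functions\<close>

lemma ptime_in_size_result: "ptime_in B e b f \<Longrightarrow> polybd B (\<lambda>x. data_size (b (f x)))"
  by (rule ptime_inE)

lemma ptime_in_expr: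
  assumes "ptime_in B e b f"
    and "\<And>(s :: store) y. s 0 = b y \<Longrightarrow> eval_expr E s = d (h y)"
    and "\<And>y. data_size (d (h y)) \<le> data_size (b y) + k"
  shows "ptime_in B e d (\<lambda>x. h (f x))"
proof (rule ptime_in_comp[OF assms(1)])
  have "polybd (\<lambda>y. data_size (b y)) (\<lambda>y. data_size (b y) + k)"
    by (intro polybd_intros)
  then have "polybd (\<lambda>y. data_size (b y)) (\<lambda>y. data_size (d (h y)))"
    by (rule polybd_mono) (rule assms(3))
  with assms(2) show "ptime b d h" by (rule ptime_expr)
qed

text \<open>Every tree is the value of a closed expression, so a constant is a single assignment of
  fixed cost.\<close>

lemma ptime_in_const: "polybd B (\<lambda>x. data_size (e x)) \<Longrightarrow> ptime_in B e b (\<lambda>x. y)"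
proof -
  assume B: "polybd B (\<lambda>x. data_size (e x))"
  have "\<exists>E. \<forall>s. eval_expr E s = d" for d
  proof (induction d)
    case NIL
    show ?case by (rule exI[of _ ENil]) simp
  next
    case (CONS d1 d2)
    then obtain E1 E2 where "\<forall>s. eval_expr E1 s = d1" "\<forall>s. eval_expr E2 s = d2" by blast
    then show ?case by (intro exI[of _ "ECons E1 E2"]) simp
  qed
  then obtain E where "\<forall>s. eval_expr E s = b y" by blast
  then show ?thesis
    by (intro ptime_in_expr[OF ptime_in_id[OF B], where h = "\<lambda>_. y" and E = E and k = "data_size (b y)"]) auto
qed

lemma ptime_const: "ptime e b (\<lambda>x. y)"
  by (rule ptime_in_const) (rule polybd_self)

lemma ptime_in_comp2:
  assumes "ptime (enc_pair a b) d (\<lambda>z. h (fst z) (snd z))" "ptime_in B e a f" "ptime_in B e b g"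
  shows "ptime_in B e d (\<lambda>x. h (f x) (g x))"
  using ptime_in_comp[OF ptime_in_pair[OF assms(2,3)] assms(1)] by simp

lemma ptime_in_comp3:
  assumes "ptime (enc_pair a (enc_pair b c)) d (\<lambda>z. h (fst z) (fst (snd z)) (snd (snd z)))"
    "ptime_in B e a f" "ptime_in B e b g" "ptime_in B e c k"
  shows "ptime_in B e d (\<lambda>x. h (f x) (g x) (k x))"
  using ptime_in_comp[OF ptime_in_pair[OF assms(2) ptime_in_pair[OF assms(3,4)]] assms(1)] by simp

lemma ptime_in_Let:
  assumes "ptime_in B e b f" "ptime (enc_pair b e) d (\<lambda>z. g (snd z) (fst z))"
  shows "ptime_in B e d (\<lambda>x. let y = f x in g x y)"
  using ptime_in_comp[OF ptime_in_pair[OF assms(1) ptime_in_id[OF ptime_in_size[OF assms(1)]]] assms(2)]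
  by simp

lemma ptime_in_fst: "ptime_in B e (enc_pair a b) f \<Longrightarrow> ptime_in B e a (\<lambda>x. fst (f x))"
  by (rule ptime_in_expr[where E = "EHd (EVar 0)" and k = 0]) (auto simp: enc_pair_def split: prod.splits)

lemma ptime_in_snd: "ptime_in B e (enc_pair a b) f \<Longrightarrow> ptime_in B e b (\<lambda>x. snd (f x))"
  by (rule ptime_in_expr[where E = "ETl (EVar 0)" and k = 0]) (auto simp: enc_pair_def split: prod.splits)

lemma ptime_in_Cons:
  "ptime_in B e a f \<Longrightarrow> ptime_in B e (enc_list a) g \<Longrightarrow> ptime_in B e (enc_list a) (\<lambda>x. f x # g x)"
  by (erule (1) ptime_in_comp2[rotated 1], rule ptime_expr[of _ "EVar 0"])
     (auto simp: enc_pair_def split: prod.splits intro!: polybd_mono[OF polybd_self])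

lemma ptime_in_tl: "ptime_in B e (enc_list a) f \<Longrightarrow> ptime_in B e (enc_list a) (\<lambda>x. tl (f x))"
proof (erule ptime_in_expr[where E = "ETl (EVar 0)" and k = 0])
  show "s 0 = enc_list a y \<Longrightarrow> eval_expr (ETl (EVar 0)) s = enc_list a (tl y)" for y and s :: store
    by (cases y) auto
  show "data_size (enc_list a (tl y)) \<le> data_size (enc_list a y) + 0" for y
    by (cases y) auto
qed

lemma ptime_in_Suc: "ptime_in B e enc_nat f \<Longrightarrow> ptime_in B e enc_nat (\<lambda>x. Suc (f x))"
  by (rule ptime_in_expr[where E = "ECons ENil (EVar 0)" and k = 2]) auto

lemma ptime_in_pred: "ptime_in B e enc_nat f \<Longrightarrow> ptime_in B e enc_nat (\<lambda>x. f x - Suc 0)"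
proof (erule ptime_in_expr[where E = "ETl (EVar 0)" and k = 0])
  show "s 0 = enc_nat y \<Longrightarrow> eval_expr (ETl (EVar 0)) s = enc_nat (y - Suc 0)" for y and s :: store
    by (cases y) auto
  show "data_size (enc_nat (y - Suc 0)) \<le> data_size (enc_nat y) + 0" for y
    by (cases y) auto
qed

text \<open>Lists of units have the same code as unary numbers. A fold over
  \<open>replicate n ()\<close> is therefore a counted loop, and recursion on numbers needs no rule
  of its own.\<close>

definition enc_unit :: "unit \<Rightarrow> data" where
  "enc_unit _ = NIL"

lemma enc_replicate_unit: "enc_list enc_unit (replicate n ()) = enc_nat n"
  by (induction n) (auto simp: enc_unit_def)

lemma enc_replicate_False: "enc_list enc_bool (replicate n False) = enc_nat n"
  by (induction n) auto

lemma ptime_in_replicate_unit: "ptime_in B e enc_nat f \<Longrightarrow> ptime_in B e (enc_list enc_unit) (\<lambda>x. replicate (f x) ())"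
  by (rule ptime_in_expr[where E = "EVar 0" and k = 0]) (auto simp: enc_replicate_unit)

lemma ptime_in_replicate_False: "ptime_in B e enc_nat f \<Longrightarrow> ptime_in B e (enc_list enc_bool) (\<lambda>x. replicate (f x) False)"
  by (rule ptime_in_expr[where E = "EVar 0" and k = 0]) (auto simp: enc_replicate_False)

lemma data_size_enc_nat [simp]: "data_size (enc_nat n) = 2 * n + 1"
  by (induction n) auto

lemma data_size_enc_bool: "data_size (enc_bool b) \<le> 3"
  by (cases b) auto

lemma ptime_in_cong: "ptime_in B e b f \<Longrightarrow> (\<And>x. f x = g x) \<Longrightarrow> ptime_in B e b g"
  using ext[of f g] by simp

lemma ptime_in_conj:
  assumes "ptime_in B e enc_bool f" "ptime_in B e enc_bool g"
  shows "ptime_in B e enc_bool (\<lambda>x. f x \<and> g x)"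
proof -
  have "ptime_in B e enc_bool (\<lambda>x. if f x then g x else False)"
    by (rule ptime_in_If assms ptime_in_const ptime_in_size[OF assms(1)])+
  then show ?thesis by (rule ptime_in_cong) simp
qed

lemma ptime_in_disj:
  assumes "ptime_in B e enc_bool f" "ptime_in B e enc_bool g"
  shows "ptime_in B e enc_bool (\<lambda>x. f x \<or> g x)"
proof -
  have "ptime_in B e enc_bool (\<lambda>x. if f x then True else g x)"
    by (rule ptime_in_If assms ptime_in_const ptime_in_size[OF assms(1)])+
  then show ?thesis by (rule ptime_in_cong) simp
qed

lemma ptime_in_not:
  assumes "ptime_in B e enc_bool f"
  shows "ptime_in B e enc_bool (\<lambda>x. \<not> f x)"
proof -
  have "ptime_in B e enc_bool (\<lambda>x. if f x then False else True)"
    by (rule ptime_in_If assms ptime_in_const ptime_in_size[OF assms(1)])+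
  then show ?thesis by (rule ptime_in_cong) simp
qed

lemma ptime_in_imp:
  assumes "ptime_in B e enc_bool f" "ptime_in B e enc_bool g"
  shows "ptime_in B e enc_bool (\<lambda>x. f x \<longrightarrow> g x)"
proof -
  have "ptime_in B e enc_bool (\<lambda>x. if f x then g x else True)"
    by (rule ptime_in_If assms ptime_in_const ptime_in_size[OF assms(1)])+
  then show ?thesis by (rule ptime_in_cong) simp
qed

lemma ptime_in_eq_bool:
  assumes "ptime_in B e enc_bool f" "ptime_in B e enc_bool g"
  shows "ptime_in B e enc_bool (\<lambda>x. f x = g x)"
proof -
  have "ptime_in B e enc_bool (\<lambda>x. if f x then g x else \<not> g x)"
    by (rule ptime_in_If ptime_in_not assms)+
  then show ?thesis by (rule ptime_in_cong) simp
qed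

lemma ptime_in_Nil_eq: "ptime_in B e (enc_list a) f \<Longrightarrow> ptime_in B e enc_bool (\<lambda>x. f x = [])"
proof -
  assume f: "ptime_in B e (enc_list a) f"
  have "ptime_in B e enc_bool (\<lambda>x. case f x of [] \<Rightarrow> True | y # ys \<Rightarrow> False)"
    by (rule ptime_in_case_list[OF f] ptime_const ptime_in_const ptime_in_size[OF f])+
  then show ?thesis
    by (rule ptime_in_cong) (auto split: list.splits)
qed

lemma ptime_in_eq_0: "ptime_in B e enc_nat f \<Longrightarrow> ptime_in B e enc_bool (\<lambda>x. f x = 0)"
  using ptime_in_Nil_eq[OF ptime_in_replicate_unit] by simp

lemma data_size_foldl_le:
  assumes "\<And>acc y. y \<in> set ys \<Longrightarrow> data_size (b (g acc y)) \<le> data_size (b acc) + m"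
  shows "data_size (b (foldl g acc ys)) \<le> data_size (b acc) + length ys * m"
  using assms
proof (induction ys arbitrary: acc)
  case (Cons y ys)
  have "data_size (b (foldl g (g acc y) ys)) \<le> data_size (b (g acc y)) + length ys * m"
    by (rule Cons.IH) (use Cons.prems in auto)
  with Cons.prems[of y acc] show ?case by simp
qed simp

lemma data_size_in_enc_list: "y \<in> set ys \<Longrightarrow> data_size (a y) \<le> data_size (enc_list a ys)"
  by (induction ys) auto

text \<open>No size bound for the accumulator is needed if each step adds to it an amount that does not
  depend on it.\<close>

lemma ptime_in_foldl_grow:
  assumes l: "ptime_in B e (enc_list a) l" and i: "ptime_in B e b i"
    and g: "ptime (enc_pair a (enc_pair b e)) b (\<lambda>z. g (snd (snd z)) (fst (snd z)) (fst z))"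
    and G: "polybd (\<lambda>z. data_size (enc_pair a e z)) G"
      "\<And>x acc y. data_size (b (g x acc y)) \<le> data_size (b acc) + G (y, x)"
  shows "ptime_in B e b (\<lambda>x. foldl (g x) (i x) (l x))"
proof -
  obtain c where c: "\<forall>z. G z \<le> (data_size (enc_pair a e z) + 2) ^ c"
    using G(1) unfolding polybd_def by blast
  define M where "M x = (data_size (enc_list a (l x)) + data_size (e x) + 3) ^ c" for x
  have GM: "G (y, x) \<le> M x" if "y \<in> set (l x)" for x y
  proof -
    have "G (y, x) \<le> (data_size (enc_pair a e (y, x)) + 2) ^ c" using c by blast
    also have "\<dots> \<le> M x" unfolding M_def
      by (rule power_mono) (use data_size_in_enc_list[OF that, of a] in auto)
    finally show ?thesis .
  qed
  show ?thesis
  proof (rule ptime_in_foldl[OF l i g])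
    show "polybd B (\<lambda>x. data_size (b (i x)) + data_size (enc_list a (l x)) * M x)"
      unfolding M_def
      by (intro polybd_intros ptime_in_size_result[OF i] ptime_in_size_result[OF l] ptime_in_size[OF l])
    fix x n
    have "data_size (b (foldl (g x) (i x) (take n (l x))))
        \<le> data_size (b (i x)) + length (take n (l x)) * M x"
    proof (rule data_size_foldl_le)
      fix acc y assume "y \<in> set (take n (l x))"
      then have "y \<in> set (l x)" by (rule in_set_takeD)
      then show "data_size (b (g x acc y)) \<le> data_size (b acc) + M x"
        using G(2)[of x acc y] GM[of y x] by linarith
    qed
    also have "length (take n (l x)) * M x \<le> data_size (enc_list a (l x)) * M x"
      using length_le_data_size[of "l x" a] by (intro mult_right_mono) auto
    finally show "data_size (b (foldl (g x) (i x) (take n (l x))))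
        \<le> data_size (b (i x)) + data_size (enc_list a (l x)) * M x" by simp
  qed
qed

lemma polybd_enc_pair_fst: "polybd (\<lambda>z. data_size (enc_pair a b z)) (\<lambda>z. data_size (a (fst z)))"
  by (rule polybd_mono[OF polybd_self]) (auto simp: enc_pair_def split: prod.splits)

lemma polybd_enc_pair_snd: "polybd (\<lambda>z. data_size (enc_pair a b z)) (\<lambda>z. data_size (b (snd z)))"
  by (rule polybd_mono[OF polybd_self]) (auto simp: enc_pair_def split: prod.splits)

section \<open>Closure rules for lists and unary arithmetic\<close>

named_theorems pt

lemmas [pt] = ptime_id ptime_in_pair ptime_in_If ptime_in_fst ptime_in_snd ptime_in_Cons ptime_in_tl
  ptime_in_Suc ptime_in_pred ptime_in_replicate_unit ptime_in_replicate_False ptime_in_conj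
  ptime_in_disj ptime_in_not ptime_in_imp ptime_in_eq_bool ptime_in_Nil_eq ptime_in_eq_0
  ptime_in_Let ptime_const

lemma foldl_replicate_unit: "foldl (\<lambda>acc _. h acc) i (replicate n ()) = (h ^^ n) i"
  by (induction n arbitrary: i) (auto simp: funpow_swap1)

lemma ptime_in_rev [pt]:
  assumes "ptime_in B e (enc_list a) l"
  shows "ptime_in B e (enc_list a) (\<lambda>x. rev (l x))"
proof -
  have "ptime (enc_list a) (enc_list a) (\<lambda>l. foldl (\<lambda>acc y. y # acc) [] l)"
    by (rule ptime_in_foldl_grow[where G = "\<lambda>z. 1 + data_size (a (fst z))"])
       (rule pt polybd_intros polybd_enc_pair_fst | simp)+
  then have "ptime (enc_list a) (enc_list a) rev"
    by (rule ptime_in_cong) (simp add: foldl_conv_fold rev_conv_fold)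
  from ptime_in_comp[OF assms this] show ?thesis .
qed

lemma ptime_in_append [pt]:
  assumes "ptime_in B e (enc_list a) f" "ptime_in B e (enc_list a) g"
  shows "ptime_in B e (enc_list a) (\<lambda>x. f x @ g x)"
proof -
  have "ptime_in B e (enc_list a) (\<lambda>x. foldl (\<lambda>acc y. y # acc) (g x) (rev (f x)))"
    by (rule ptime_in_foldl_grow[where G = "\<lambda>z. 1 + data_size (a (fst z))" and a = a])
       (rule pt polybd_intros polybd_enc_pair_fst assms | simp)+
  moreover have "foldl (\<lambda>acc y. y # acc) ys (rev xs) = xs @ ys" for xs ys :: "'b list"
    by (induction xs) auto
  ultimately show ?thesis by simp
qed

lemma data_size_enc_append: "data_size (enc_list a (xs @ ys)) + 1 = data_size (enc_list a xs) + data_size (enc_list a ys)"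
  by (induction xs) auto

lemma ptime_in_concat [pt]:
  assumes "ptime_in B e (enc_list (enc_list a)) f"
  shows "ptime_in B e (enc_list a) (\<lambda>x. concat (f x))"
proof -
  have "ptime (enc_list (enc_list a)) (enc_list a) (\<lambda>l. foldl (\<lambda>acc y. acc @ y) [] l)"
  proof (rule ptime_in_foldl_grow[where G = "\<lambda>z. data_size (enc_list a (fst z))"])
    show "data_size (enc_list a (acc @ y)) \<le> data_size (enc_list a acc) + data_size (enc_list a (fst (y, x)))" for acc y x
      using data_size_enc_append[of a acc y] by simp
  qed (rule pt polybd_enc_pair_fst)+
  moreover have "foldl (\<lambda>acc y. acc @ y) zs l = zs @ concat l" for zs :: "'b list" and l
    by (induction l arbitrary: zs) auto
  ultimately have "ptime (enc_list (enc_list a)) (enc_list a) concat"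
    by (simp add: fun_eq_iff)
  from ptime_in_comp[OF assms this] show ?thesis .
qed

text \<open>The mapped function may depend on the outer input \<open>x\<close>. The hypothesis on
  \<open>h\<close> makes this environment explicit by pairing it with the list entry, so
  abstractions with free variables are covered.\<close>

lemma ptime_in_map [pt]:
  assumes l: "ptime_in B e (enc_list a) l" and h: "ptime (enc_pair a e) b (\<lambda>z. h (snd z) (fst z))"
  shows "ptime_in B e (enc_list b) (\<lambda>x. map (h x) (l x))"
proof -
  have "ptime_in B e (enc_list b) (\<lambda>x. foldl (\<lambda>acc y. h x y # acc) [] (l x))"
  proof (rule ptime_in_foldl_grow[OF l, where G = "\<lambda>z. 1 + data_size (b (h (snd z) (fst z)))"])
    show "ptime_in B e (enc_list b) (\<lambda>x. [])"
      by (rule ptime_in_const[OF ptime_in_size[OF l]])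
    have "ptime (enc_pair a (enc_pair (enc_list b) e)) (enc_pair a e) (\<lambda>z. (fst z, snd (snd z)))"
      by (rule pt)+
    from ptime_in_comp[OF this h]
    have "ptime (enc_pair a (enc_pair (enc_list b) e)) b (\<lambda>z. h (snd (snd z)) (fst z))"
      by simp
    then show "ptime (enc_pair a (enc_pair (enc_list b) e)) (enc_list b)
        (\<lambda>z. h (snd (snd z)) (fst z) # fst (snd z))"
      by - (rule pt | assumption)+
    show "polybd (\<lambda>z. data_size (enc_pair a e z)) (\<lambda>z. 1 + data_size (b (h (snd z) (fst z))))"
      by (intro polybd_intros ptime_in_size_result[OF h])
  qed simp
  then have "ptime_in B e (enc_list b) (\<lambda>x. rev (foldl (\<lambda>acc y. h x y # acc) [] (l x)))"
    by (rule ptime_in_rev)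
  moreover have "foldl (\<lambda>acc y. h x y # acc) zs ys = rev (map (h x) ys) @ zs" for x zs ys
    by (induction ys arbitrary: zs) auto
  ultimately show ?thesis by simp
qed

lemma ptime_in_filter [pt]:
  assumes l: "ptime_in B e (enc_list a) l" and h: "ptime (enc_pair a e) enc_bool (\<lambda>z. h (snd z) (fst z))"
  shows "ptime_in B e (enc_list a) (\<lambda>x. filter (h x) (l x))"
proof -
  have "ptime (enc_pair a e) (enc_list a) (\<lambda>z. if h (snd z) (fst z) then [fst z] else [])"
    by (rule pt h)+
  then have "ptime_in B e (enc_list a) (\<lambda>x. concat (map (\<lambda>y. if h x y then [y] else []) (l x)))"
    by - (assumption | rule pt l)+
  moreover have "concat (map (\<lambda>y. if h x y then [y] else []) ys) = filter (h x) ys" for x ys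
    by (induction ys) auto
  ultimately show ?thesis by simp
qed

lemma ptime_in_Bex [pt]:
  assumes l: "ptime_in B e (enc_list a) l" and h: "ptime (enc_pair a e) enc_bool (\<lambda>z. h (snd z) (fst z))"
  shows "ptime_in B e enc_bool (\<lambda>x. \<exists>y\<in>set (l x). h x y)"
proof -
  have "ptime_in B e enc_bool (\<lambda>x. \<not> filter (h x) (l x) = [])"
    by (rule pt assms)+
  then show ?thesis by (simp add: filter_empty_conv)
qed

lemma ptime_in_Ball [pt]:
  assumes l: "ptime_in B e (enc_list a) l" and h: "ptime (enc_pair a e) enc_bool (\<lambda>z. h (snd z) (fst z))"
  shows "ptime_in B e enc_bool (\<lambda>x. \<forall>y\<in>set (l x). h x y)"
proof -
  have "ptime_in B e enc_bool (\<lambda>x. \<not> (\<exists>y\<in>set (l x). \<not> h x y))"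
    by (rule pt assms)+
  then show ?thesis by simp
qed

lemma ptime_in_add [pt]:
  assumes "ptime_in B e enc_nat f" "ptime_in B e enc_nat g"
  shows "ptime_in B e enc_nat (\<lambda>x. f x + g x)"
proof (rule ptime_in_comp2[OF _ assms])
  let ?e = "enc_pair enc_nat enc_nat"
  have "ptime ?e enc_nat (\<lambda>z. foldl (\<lambda>acc _. Suc acc) (fst z) (replicate (snd z) ()))"
    by (rule ptime_in_foldl_grow[where G = "\<lambda>_. 2" and a = enc_unit])
       (rule pt polybd_intros | simp)+
  moreover have "(Suc ^^ n) m = m + n" for m n by (induction n) auto
  ultimately show "ptime ?e enc_nat (\<lambda>z. fst z + snd z)"
    by (simp add: foldl_replicate_unit add.commute)
qed

lemma ptime_in_diff [pt]:
  assumes "ptime_in B e enc_nat f" "ptime_in B e enc_nat g"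
  shows "ptime_in B e enc_nat (\<lambda>x. f x - g x)"
proof (rule ptime_in_comp2[OF _ assms])
  let ?e = "enc_pair enc_nat enc_nat"
  have "ptime ?e enc_nat (\<lambda>z. foldl (\<lambda>acc _. acc - Suc 0) (fst z) (replicate (snd z) ()))"
    by (rule ptime_in_foldl_grow[where G = "\<lambda>_. 0" and a = enc_unit])
       (rule pt polybd_intros | simp)+
  moreover have "((\<lambda>a. a - Suc 0) ^^ n) m = m - n" for m n by (induction n) auto
  ultimately show "ptime ?e enc_nat (\<lambda>z. fst z - snd z)"
    by (simp add: foldl_replicate_unit)
qed

lemma ptime_in_mult [pt]:
  assumes "ptime_in B e enc_nat f" "ptime_in B e enc_nat g"
  shows "ptime_in B e enc_nat (\<lambda>x. f x * g x)"
proof (rule ptime_in_comp2[OF _ assms])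
  let ?e = "enc_pair enc_nat enc_nat"
  have "ptime ?e enc_nat (\<lambda>z. foldl (\<lambda>acc _. acc + fst z) 0 (replicate (snd z) ()))"
  proof (rule ptime_in_foldl_grow[where G = "\<lambda>z. data_size (?e (snd z))" and a = enc_unit])
    show "data_size (enc_nat (acc + fst x)) \<le> data_size (enc_nat acc) + data_size (?e (snd (y, x)))"
      for acc x and y :: unit
      by (cases x) simp
  qed (rule pt polybd_enc_pair_snd)+
  moreover have "((\<lambda>a. a + m) ^^ n) 0 = m * n" for m n :: nat by (induction n) auto
  ultimately show "ptime ?e enc_nat (\<lambda>z. fst z * snd z)"
    by (simp add: foldl_replicate_unit)
qed

lemma ptime_in_le [pt]:
  assumes "ptime_in B e enc_nat f" "ptime_in B e enc_nat g"
  shows "ptime_in B e enc_bool (\<lambda>x. f x \<le> g x)"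
proof -
  have "ptime_in B e enc_bool (\<lambda>x. f x - g x = 0)" by (rule pt assms)+
  then show ?thesis by simp
qed

lemma ptime_in_less [pt]:
  assumes "ptime_in B e enc_nat f" "ptime_in B e enc_nat g"
  shows "ptime_in B e enc_bool (\<lambda>x. f x < g x)"
  using ptime_in_not[OF ptime_in_le[OF assms(2,1)]] by (simp add: not_le)

lemma ptime_in_eq_nat [pt]:
  assumes "ptime_in B e enc_nat f" "ptime_in B e enc_nat g"
  shows "ptime_in B e enc_bool (\<lambda>x. f x = g x)"
  using ptime_in_conj[OF ptime_in_le[OF assms] ptime_in_le[OF assms(2,1)]] by (simp add: eq_iff)

lemma ptime_in_drop [pt]:
  assumes "ptime_in B e enc_nat f" "ptime_in B e (enc_list a) g"
  shows "ptime_in B e (enc_list a) (\<lambda>x. drop (f x) (g x))"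
proof (rule ptime_in_comp2[OF _ assms])
  let ?e = "enc_pair enc_nat (enc_list a)"
  have tl: "data_size (enc_list a (tl ys)) \<le> data_size (enc_list a ys)" for ys
    by (cases ys) auto
  have "ptime ?e (enc_list a) (\<lambda>z. foldl (\<lambda>acc _. tl acc) (snd z) (replicate (fst z) ()))"
    by (rule ptime_in_foldl_grow[where G = "\<lambda>_. 0" and a = enc_unit])
       (rule pt polybd_intros | simp add: tl)+
  moreover have "(tl ^^ n) xs = drop n xs" for n and xs :: "'b list"
    by (induction n) (auto simp: drop_Suc tl_drop)
  ultimately show "ptime ?e (enc_list a) (\<lambda>z. drop (fst z) (snd z))"
    by (simp add: foldl_replicate_unit)
qed

lemma ptime_in_length [pt]:
  assumes "ptime_in B e (enc_list a) f"
  shows "ptime_in B e enc_nat (\<lambda>x. length (f x))"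
proof (rule ptime_in_comp[OF assms])
  have "ptime (enc_list a) enc_nat (\<lambda>l. foldl (\<lambda>acc _. Suc acc) 0 l)"
    by (rule ptime_in_foldl_grow[where G = "\<lambda>_. 2" and a = a])
       (rule pt polybd_intros | simp)+
  moreover have "foldl (\<lambda>acc _. Suc acc) n l = n + length l" for n and l :: "'b list"
    by (induction l arbitrary: n) auto
  ultimately show "ptime (enc_list a) enc_nat length" by simp
qed

lemma ptime_in_upt [pt]:
  assumes "ptime_in B e enc_nat f"
  shows "ptime_in B e (enc_list enc_nat) (\<lambda>x. [0..<f x])"
proof (rule ptime_in_comp[OF assms])
  let ?h = "\<lambda>p :: nat \<times> nat list. (Suc (fst p), fst p # snd p)"
  have h: "foldl (\<lambda>p _. ?h p) (0, []) (replicate n ()) = (n, rev [0..<n])" for n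
    unfolding foldl_replicate_unit by (induction n) auto
  have sz: "data_size (enc_list enc_nat (rev [0..<n])) = 1 + n * (n + 1)" for n
    by (induction n) (auto simp: algebra_simps)
  have "ptime enc_nat (enc_pair enc_nat (enc_list enc_nat)) (\<lambda>n. foldl (\<lambda>p _. ?h p) (0, []) (replicate n ()))"
  \<comment> \<open>Each step copies the counter, which is itself part of the accumulator. The
    growth thus depends on the accumulator, and an explicit size bound is given instead of a bound
    per step.\<close>
  proof (rule ptime_in_foldl[where a = enc_unit])
    show "polybd (\<lambda>x. data_size (enc_nat x)) (\<lambda>n. 3 + data_size (enc_nat n) + data_size (enc_nat n) * (data_size (enc_nat n) + 1))"
      by (intro polybd_intros)
    fix x n
    have t: "take n (replicate x ()) = replicate (min n x) ()" by simp
    have "min n x * (min n x + 1) \<le> x * (x + 1)" by (intro mult_mono) auto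
    also have "\<dots> \<le> (2 * x + 1) * (2 * x + 1 + 1)" by (intro mult_mono) auto
    finally show "data_size (enc_pair enc_nat (enc_list enc_nat) (foldl (\<lambda>p _. ?h p) (0, []) (take n (replicate x ()))))
      \<le> 3 + data_size (enc_nat x) + data_size (enc_nat x) * (data_size (enc_nat x) + 1)"
      unfolding t h enc_pair_simp data_size.simps sz data_size_enc_nat by linarith
  qed (rule pt)+
  then have "ptime enc_nat (enc_list enc_nat) (\<lambda>n. rev (snd (foldl (\<lambda>p _. ?h p) (0, []) (replicate n ()))))"
    by - (rule pt | assumption)+
  then show "ptime enc_nat (enc_list enc_nat) (\<lambda>n. [0..<n])" unfolding h by simp
qed

lemma ptime_in_zip [pt]:
  assumes "ptime_in B e (enc_list a) f" "ptime_in B e (enc_list b) g"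
  shows "ptime_in B e (enc_list (enc_pair a b)) (\<lambda>x. zip (f x) (g x))"
proof (rule ptime_in_comp2[OF _ assms])
  let ?e = "enc_pair (enc_list a) (enc_list b)"
  let ?b = "enc_pair (enc_list b) (enc_list (enc_pair a b))"
  let ?g = "\<lambda>acc y. case fst acc of [] \<Rightarrow> acc | u # us \<Rightarrow> (us, (y, u) # snd acc)"
  have "ptime ?e ?b (\<lambda>z. foldl ?g (snd z, []) (fst z))"
  proof (rule ptime_in_foldl_grow[where G = "\<lambda>z. 1 + data_size (a (fst z))" and a = a])
    \<comment> \<open>The entry \<open>u\<close> only moves from one component to the other; what is
      added is \<open>y\<close> and one node.\<close>
    show "data_size (?b (?g acc y)) \<le> data_size (?b acc) + (1 + data_size (a (fst (y, x))))" for acc y x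
      by (cases acc; cases "fst acc") auto
    show "ptime (enc_pair a (enc_pair ?b ?e)) ?b (\<lambda>z. ?g (fst (snd z)) (fst z))"
      by (rule ptime_in_case_list) (rule pt)+
  qed (rule pt polybd_intros polybd_enc_pair_fst)+
  then have *: "ptime ?e (enc_list (enc_pair a b)) (\<lambda>z. rev (snd (foldl ?g (snd z, []) (fst z))))"
    by - (rule pt | assumption)+
  have zip: "rev (snd (foldl ?g (ys, acc) xs)) = rev acc @ zip xs ys" for xs ys acc
    by (induction xs arbitrary: ys acc) (auto split: list.split)
  show "ptime ?e (enc_list (enc_pair a b)) (\<lambda>z. zip (fst z) (snd z))"
    by (rule ptime_in_cong[OF *]) (simp only: zip rev.simps append_Nil)
qed

lemma ptime_in_take [pt]:
  assumes "ptime_in B e enc_nat f" "ptime_in B e (enc_list a) g"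
  shows "ptime_in B e (enc_list a) (\<lambda>x. take (f x) (g x))"
proof -
  have "ptime_in B e (enc_list a) (\<lambda>x. map (\<lambda>y. fst y) (zip (g x) [0..<f x]))"
    by (rule pt assms)+
  moreover have "map (\<lambda>y. fst y) (zip ys [0..<n]) = take n ys" for n and ys :: "'b list"
    by (simp add: map_fst_zip_take min_def)
  ultimately show ?thesis by simp
qed

lemmas [pt] = ptime_in_case_list

subsection \<open>All words of a given length\<close>

primrec bitlists :: "nat \<Rightarrow> bool list list" where
  "bitlists 0 = [[]]"
| "bitlists (Suc n) = map ((#) False) (bitlists n) @ map ((#) True) (bitlists n)"

lemma set_bitlists: "set (bitlists n) = {w. length w = n}"
proof (induction n)
  case (Suc n)
  show ?case
  proof (intro equalityI subsetI)
    fix w :: "bool list" assume "w \<in> {w. length w = Suc n}"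
    then obtain b v where "w = b # v" "length v = n" by (auto simp: length_Suc_conv)
    then show "w \<in> set (bitlists (Suc n))" using Suc by (cases b) auto
  qed (use Suc in auto)
qed auto

lemma distinct_bitlists: "distinct (bitlists n)"
  by (induction n) (auto simp: distinct_map)

lemma data_size_bitlists: "data_size (enc_list (enc_list enc_bool) (bitlists n)) \<le> 1 + 2 ^ n * (4 * n + 2)"
proof -
  have "data_size (enc_list enc_bool w) \<le> 4 * length w + 1" for w
    by (induction w) (use data_size_enc_bool in \<open>auto simp: le_diff_conv intro: add_mono order_trans\<close>)
  then have w: "data_size (enc_list enc_bool w) \<le> 4 * n + 1" if "w \<in> set (bitlists n)" for w
    using that by (metis mem_Collect_eq set_bitlists)
  have "data_size (enc_list a ws) \<le> 1 + length ws * (m + 1)" if "\<forall>w\<in>set ws. data_size (a w) \<le> m"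
    for a :: "bool list \<Rightarrow> data" and ws m
    using that by (induction ws) auto
  from this[of "bitlists n" "enc_list enc_bool" "4 * n + 1"] w
  have "data_size (enc_list (enc_list enc_bool) (bitlists n)) \<le> 1 + length (bitlists n) * (4 * n + 2)"
    by simp
  moreover have "length (bitlists n) = 2 ^ n" by (induction n) auto
  ultimately show ?thesis by simp
qed

text \<open>The only exponential ingredient of the reduction. The list doubles in each step, so the
  budget has to cover the number of words.\<close>

lemma ptime_in_bitlists:
  assumes "ptime_in B e enc_nat f" "polybd B (\<lambda>x. 2 ^ f x)"
  shows "ptime_in B e (enc_list (enc_list enc_bool)) (\<lambda>x. bitlists (f x))"
proof -
  let ?g = "\<lambda>acc. map ((#) False) acc @ map ((#) True) acc"
  have bl: "foldl (\<lambda>acc _. ?g acc) [[]] (replicate n ()) = bitlists n" for n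
    unfolding foldl_replicate_unit by (induction n) auto
  have "ptime_in B e (enc_list (enc_list enc_bool)) (\<lambda>x. foldl (\<lambda>acc _. ?g acc) [[]] (replicate (f x) ()))"
  proof (rule ptime_in_foldl[where a = enc_unit])
    have "polybd B (\<lambda>x. data_size (enc_nat (f x)))" by (rule ptime_in_size_result[OF assms(1)])
    then have "polybd B f" by (rule polybd_mono) simp
    then show "polybd B (\<lambda>x. 1 + 2 ^ f x * (4 * f x + 2))"
      by (intro polybd_intros assms(2))
    fix x n
    have t: "take n (replicate (f x) ()) = replicate (min n (f x)) ()" by simp
    have "1 + 2 ^ min n (f x) * (4 * min n (f x) + 2) \<le> 1 + (2::nat) ^ f x * (4 * f x + 2)"
      by (intro add_left_mono mult_mono) auto
    with data_size_bitlists[of "min n (f x)"]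
    show "data_size (enc_list (enc_list enc_bool) (foldl (\<lambda>acc _. ?g acc) [[]] (take n (replicate (f x) ()))))
      \<le> 1 + 2 ^ f x * (4 * f x + 2)"
      unfolding t bl by linarith
  qed (rule pt assms ptime_in_const ptime_in_size[OF assms(1)])+
  then show ?thesis unfolding bl .
qed

subsection \<open>The reduction\<close>

text \<open>An entry \<open>((i, s), v)\<close> reserves the crossing of row \<open>i\<close> and
  column \<open>s\<close> for the variable \<open>v\<close>.\<close>

type_synonym placed = "((nat \<times> nat) \<times> nat) list"

definition row_clauses :: "nat \<Rightarrow> literal list list \<Rightarrow> nat \<Rightarrow> literal list list" where
  "row_clauses q cls i = take q (drop (i * q) cls)"

definition vars :: "literal list list \<Rightarrow> nat list" where
  "vars cs = map fst (concat cs)"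

definition occurrences :: "nat \<Rightarrow> literal list list \<Rightarrow> (nat \<times> nat) list" where
  "occurrences q cls = concat (map (\<lambda>i. map (\<lambda>v. (v, i)) (vars (row_clauses q cls i))) [0..<q])"

definition rows_of :: "(nat \<times> nat) list \<Rightarrow> nat \<Rightarrow> nat list" where
  "rows_of occ v = map snd (filter (\<lambda>p. fst p = v) occ)"

text \<open>Repeated occurrences of a variable within a row are kept, so a link may join a row to
  itself. This is harmless and already included in the count of link ends.\<close>

definition links :: "nat \<Rightarrow> (nat \<times> nat) list \<Rightarrow> (nat \<times> nat \<times> nat) list" where
  "links n occ =
     concat (map (\<lambda>v. map (\<lambda>p. (v, p)) (zip (rows_of occ v) (tl (rows_of occ v)))) [0..<n])"

definition free_columns :: "nat \<Rightarrow> placed \<Rightarrow> nat \<times> nat \<Rightarrow> nat list" where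
  "free_columns k acc ab =
     filter (\<lambda>s. \<not> (\<exists>y\<in>set acc. snd (fst y) = s \<and> (fst (fst y) = fst ab \<or> fst (fst y) = snd ab))) [0..<k]"

text \<open>Both rows receive the same column, so that one vertical slot carries \<open>v\<close> at
  both crossings. The empty case is a default that does not arise once there are enough
  columns.\<close>

definition place :: "nat \<Rightarrow> placed \<Rightarrow> nat \<times> nat \<times> nat \<Rightarrow> placed" where
  "place k acc r = (case free_columns k acc (snd r) of
     [] \<Rightarrow> acc
   | s # _ \<Rightarrow> ((fst (snd r), s), fst r) # ((snd (snd r), s), fst r) # acc)"

definition placement :: "nat \<Rightarrow> (nat \<times> nat \<times> nat) list \<Rightarrow> placed" where
  "placement k rs = foldl (place k) [] rs"

text \<open>A crossing that no link uses is labelled by the non-variable \<open>n\<close>.\<close>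

definition label :: "nat \<Rightarrow> placed \<Rightarrow> nat \<Rightarrow> nat \<Rightarrow> nat" where
  "label n acc i s = (case filter (\<lambda>p. fst (fst p) = i \<and> snd (fst p) = s) acc of
     [] \<Rightarrow> n
   | y # _ \<Rightarrow> snd y)"

text \<open>
  A slot is described by the labels of its cells and the clauses it has to satisfy. Behind its crossings
  a horizontal slot has one cell for each variable occurrence of its clauses, so that a word determines
  the assignment. All words have length \<open>l\<close>, apart from the padding by \<open>j\<close> letters for the \<open>j\<close>-th slot.
\<close>

definition row_entity :: "nat \<Rightarrow> nat \<Rightarrow> nat \<Rightarrow> literal list list \<Rightarrow> placed \<Rightarrow> nat \<Rightarrow> nat list \<times> literal list list" where
  "row_entity n q k cls acc i =
     (map (\<lambda>s. label n acc i s) [0..<k] @ vars (row_clauses q cls i), row_clauses q cls i)"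

text \<open>With no clauses to satisfy, a column only forces its equally labelled crossings to carry
  equal letters.\<close>

definition column_entity :: "nat \<Rightarrow> nat \<Rightarrow> placed \<Rightarrow> nat \<Rightarrow> nat list \<times> literal list list" where
  "column_entity n q acc s = (map (\<lambda>i. label n acc i s) [0..<q], [])"

text \<open>Since \<open>zip\<close> stops at the last label, letters behind the labelled cells are
  unconstrained. Bounded quantifiers over lists keep the predicate within reach of the closure
  rules.\<close>

definition good :: "nat list \<times> literal list list \<Rightarrow> bool list \<Rightarrow> bool" where
  "good E w \<longleftrightarrow>
     (\<forall>y\<in>set (zip (fst E) w). \<forall>z\<in>set (zip (fst E) w). fst y = fst z \<longrightarrow> snd y = snd z) \<and>
     (\<forall>c\<in>set (snd E). \<exists>l\<in>set c. \<exists>y\<in>set (zip (fst E) w). fst y = fst l \<and> snd y = snd l)"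

definition dictionary :: "bool list list \<Rightarrow> (nat list \<times> literal list list) list \<Rightarrow> bool list list" where
  "dictionary ws es =
     concat (map (\<lambda>p. map (\<lambda>w. w @ replicate (fst p) False) (filter (\<lambda>w. good (snd p) w) ws))
       (zip [0..<length es] es))"

definition slot_data :: "nat \<Rightarrow> nat \<Rightarrow> nat \<Rightarrow> (bool \<times> nat \<times> nat \<times> nat) list" where
  "slot_data l q k =
     map (\<lambda>i. (False, i, 0, l + i)) [0..<q] @ map (\<lambda>s. (True, 0, s, l + q + s)) [0..<k]"

text \<open>The counted numbers are those from \<open>0\<close> up to, but not including, the
  rounded-up root; counting them avoids any search for a root.\<close>

definition ceil_sqrt :: "nat \<Rightarrow> nat" where
  "ceil_sqrt m = length (filter (\<lambda>j. j * j < m) [0..<m])"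

text \<open>The word list is a parameter: relative to its size everything here takes polynomial
  time. The result is a tuple built from pairs, lists and numbers, to which the closure rules apply.
  In \<open>l\<close>, the first \<open>k\<close> cells are for crossings and the other
  \<open>3 * q\<close> for the literals of at most \<open>q\<close> clauses.\<close>

definition crossword_data ::
  "bool list list \<Rightarrow> nat \<Rightarrow> literal list list \<Rightarrow> nat \<Rightarrow>
    bool list list \<times> nat \<times> nat \<times> (bool \<times> nat \<times> nat \<times> nat) list" where
  "crossword_data ws n cls q = (let k = 12 * q + 1; l = k + 3 * q;
      acc = placement k (links n (occurrences q cls)) in
    (dictionary ws (map (\<lambda>i. row_entity n q k cls acc i) [0..<q] @ map (\<lambda>s. column_entity n q acc s) [0..<k]),
     l + q + k, l + q + k, slot_data l q k))"

section \<open>The reduction, given the word list, runs in polynomial time\<close>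

abbreviation "enc_clauses \<equiv> enc_list (enc_list (enc_pair enc_nat enc_bool))"
abbreviation "enc_placed \<equiv> enc_list (enc_pair (enc_pair enc_nat enc_nat) enc_nat)"
abbreviation "enc_link \<equiv> enc_pair enc_nat (enc_pair enc_nat enc_nat)"
abbreviation "enc_entity \<equiv> enc_pair (enc_list enc_nat) enc_clauses"
abbreviation "enc_words \<equiv> enc_list (enc_list enc_bool)"
abbreviation "enc_slots \<equiv> enc_list (enc_pair enc_bool (enc_pair enc_nat (enc_pair enc_nat enc_nat)))"

lemma ptime_row_clauses [pt]:
  assumes "ptime_in B e enc_nat q" "ptime_in B e enc_clauses cls" "ptime_in B e enc_nat i"
  shows "ptime_in B e enc_clauses (\<lambda>x. row_clauses (q x) (cls x) (i x))"
  unfolding row_clauses_def by (rule pt assms)+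

lemma ptime_vars [pt]:
  assumes "ptime_in B e enc_clauses cs"
  shows "ptime_in B e (enc_list enc_nat) (\<lambda>x. vars (cs x))"
  unfolding vars_def by (rule pt assms)+

text \<open>Inside \<open>map\<close> the parameters must be polynomial time relative to the input
  itself rather than to \<open>B\<close>. Making the pair of parameters the input achieves this; the
  same device serves the later definitions that use abstractions.\<close>

lemma ptime_occurrences [pt]:
  assumes "ptime_in B e enc_nat q" "ptime_in B e enc_clauses cls"
  shows "ptime_in B e (enc_list (enc_pair enc_nat enc_nat)) (\<lambda>x. occurrences (q x) (cls x))"
  by (rule ptime_in_comp2[OF _ assms]) (unfold occurrences_def, (rule pt)+)

lemma ptime_rows_of [pt]:
  assumes "ptime_in B e (enc_list (enc_pair enc_nat enc_nat)) occ" "ptime_in B e enc_nat v"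
  shows "ptime_in B e (enc_list enc_nat) (\<lambda>x. rows_of (occ x) (v x))"
  by (rule ptime_in_comp2[OF _ assms]) (unfold rows_of_def, (rule pt)+)

lemma ptime_links [pt]:
  assumes "ptime_in B e enc_nat n" "ptime_in B e (enc_list (enc_pair enc_nat enc_nat)) occ"
  shows "ptime_in B e (enc_list enc_link) (\<lambda>x. links (n x) (occ x))"
  by (rule ptime_in_comp2[OF _ assms]) (unfold links_def, (rule pt)+)

lemma ptime_free_columns [pt]:
  assumes "ptime_in B e enc_nat k" "ptime_in B e enc_placed acc" "ptime_in B e (enc_pair enc_nat enc_nat) ab"
  shows "ptime_in B e (enc_list enc_nat) (\<lambda>x. free_columns (k x) (acc x) (ab x))"
  by (rule ptime_in_comp3[OF _ assms]) (unfold free_columns_def, (rule pt)+)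

lemma ptime_place [pt]:
  assumes "ptime_in B e enc_nat k" "ptime_in B e enc_placed acc" "ptime_in B e enc_link r"
  shows "ptime_in B e enc_placed (\<lambda>x. place (k x) (acc x) (r x))"
  by (rule ptime_in_comp3[OF _ assms]) (unfold place_def, (rule pt)+)

lemma ptime_placement [pt]:
  assumes "ptime_in B e enc_nat k" "ptime_in B e (enc_list enc_link) rs"
  shows "ptime_in B e enc_placed (\<lambda>x. placement (k x) (rs x))"
proof (rule ptime_in_comp2[OF _ assms])
  let ?e = "enc_pair enc_nat (enc_list enc_link)"
  show "ptime ?e enc_placed (\<lambda>z. placement (fst z) (snd z))"
    unfolding placement_def
  proof (rule ptime_in_foldl_grow[where a = enc_link and
        G = "\<lambda>z. 2 * data_size (enc_link (fst z)) + 2 * data_size (?e (snd z)) + 10"])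
    fix x :: "nat \<times> (nat \<times> nat \<times> nat) list" and acc and y :: "nat \<times> nat \<times> nat"
    obtain v a b where y: "y = (v, a, b)" by (cases y)
    obtain k rs where x: "x = (k, rs)" by (cases x)
    show "data_size (enc_placed (place (fst x) acc y)) \<le> data_size (enc_placed acc)
      + (2 * data_size (enc_link (fst (y, x))) + 2 * data_size (?e (snd (y, x))) + 10)"
    proof (cases "free_columns k acc (a, b)")
      case (Cons s ss)
      \<comment> \<open>The column chosen is below \<open>k\<close>, whose unary code is part of the
        input, so the two new entries have a size independent of \<open>acc\<close>.\<close>
      then have "s \<in> set (free_columns k acc (a, b))" by simp
      then have "s < k" by (simp add: free_columns_def)
      then show ?thesis using Cons by (simp add: place_def x y)
    qed (simp add: place_def x y)
  qed (rule pt polybd_intros polybd_enc_pair_fst polybd_enc_pair_snd)+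
qed

lemma ptime_label [pt]:
  assumes "ptime_in B e enc_nat n" "ptime_in B e enc_placed acc" "ptime_in B e enc_nat i" "ptime_in B e enc_nat s"
  shows "ptime_in B e enc_nat (\<lambda>x. label (n x) (acc x) (i x) (s x))"
proof -
  have "ptime (enc_pair enc_nat (enc_pair enc_placed (enc_pair enc_nat enc_nat))) enc_nat
    (\<lambda>z. label (fst z) (fst (snd z)) (fst (snd (snd z))) (snd (snd (snd z))))"
    unfolding label_def by (rule pt)+
  from ptime_in_comp[OF ptime_in_pair[OF assms(1) ptime_in_pair[OF assms(2) ptime_in_pair[OF assms(3,4)]]] this]
  show ?thesis by simp
qed

lemma ptime_row_entity [pt]:
  assumes "ptime_in B e enc_nat n" "ptime_in B e enc_nat q" "ptime_in B e enc_nat k"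
    "ptime_in B e enc_clauses cls" "ptime_in B e enc_placed acc" "ptime_in B e enc_nat i"
  shows "ptime_in B e enc_entity (\<lambda>x. row_entity (n x) (q x) (k x) (cls x) (acc x) (i x))"
proof -
  let ?e = "enc_pair enc_nat (enc_pair enc_nat (enc_pair enc_nat (enc_pair enc_clauses (enc_pair enc_placed enc_nat))))"
  have "ptime ?e enc_entity (\<lambda>z. row_entity (fst z) (fst (snd z)) (fst (snd (snd z)))
      (fst (snd (snd (snd z)))) (fst (snd (snd (snd (snd z))))) (snd (snd (snd (snd (snd z))))))"
    unfolding row_entity_def by (rule pt)+
  from ptime_in_comp[OF ptime_in_pair[OF assms(1) ptime_in_pair[OF assms(2) ptime_in_pair[OF assms(3)
    ptime_in_pair[OF assms(4) ptime_in_pair[OF assms(5,6)]]]]] this]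
  show ?thesis by simp
qed

lemma ptime_column_entity [pt]:
  assumes "ptime_in B e enc_nat n" "ptime_in B e enc_nat q" "ptime_in B e enc_placed acc" "ptime_in B e enc_nat s"
  shows "ptime_in B e enc_entity (\<lambda>x. column_entity (n x) (q x) (acc x) (s x))"
proof -
  have "ptime (enc_pair enc_nat (enc_pair enc_nat (enc_pair enc_placed enc_nat))) enc_entity
    (\<lambda>z. column_entity (fst z) (fst (snd z)) (fst (snd (snd z))) (snd (snd (snd z))))"
    unfolding column_entity_def by (rule pt)+
  from ptime_in_comp[OF ptime_in_pair[OF assms(1) ptime_in_pair[OF assms(2) ptime_in_pair[OF assms(3,4)]]] this]
  show ?thesis by simp
qed

lemma ptime_good [pt]:
  assumes "ptime_in B e enc_entity E" "ptime_in B e (enc_list enc_bool) w"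
  shows "ptime_in B e enc_bool (\<lambda>x. good (E x) (w x))"
  by (rule ptime_in_comp2[OF _ assms]) (unfold good_def, (rule pt)+)

lemma ptime_dictionary [pt]:
  assumes "ptime_in B e enc_words ws" "ptime_in B e (enc_list enc_entity) es"
  shows "ptime_in B e enc_words (\<lambda>x. dictionary (ws x) (es x))"
  by (rule ptime_in_comp2[OF _ assms]) (unfold dictionary_def, (rule pt)+)

lemma ptime_slot_data [pt]:
  assumes "ptime_in B e enc_nat l" "ptime_in B e enc_nat q" "ptime_in B e enc_nat k"
  shows "ptime_in B e enc_slots (\<lambda>x. slot_data (l x) (q x) (k x))"
  by (rule ptime_in_comp3[OF _ assms]) (unfold slot_data_def, (rule pt)+)

lemma ptime_ceil_sqrt [pt]:
  assumes "ptime_in B e enc_nat m"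
  shows "ptime_in B e enc_nat (\<lambda>x. ceil_sqrt (m x))"
proof (rule ptime_in_comp[OF assms])
  show "ptime enc_nat enc_nat ceil_sqrt"
    unfolding ceil_sqrt_def[abs_def] by (rule pt)+
qed

lemma ptime_crossword_data:
  "ptime (enc_pair enc_words (enc_pair enc_nat (enc_pair enc_clauses enc_nat)))
     (enc_pair enc_words (enc_pair enc_nat (enc_pair enc_nat enc_slots)))
     (\<lambda>z. crossword_data (fst z) (fst (snd z)) (fst (snd (snd z))) (snd (snd (snd z))))"
  unfolding crossword_data_def by (rule pt)+

subsection \<open>Correctness of the reduction\<close>

lemma in_set_zip_upt: "(j, y) \<in> set (zip [0..<length ys] ys) \<longleftrightarrow> j < length ys \<and> y = ys ! j"
  by (auto simp: set_zip intro!: exI[of _ j])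

lemma set_dictionary:
  "u \<in> set (dictionary ws es) \<longleftrightarrow>
     (\<exists>j<length es. \<exists>w\<in>set ws. good (es ! j) w \<and> u = w @ replicate j False)"
proof -
  have "u \<in> set (dictionary ws es) \<longleftrightarrow> (\<exists>p\<in>set (zip [0..<length es] es).
      \<exists>w\<in>set ws. good (snd p) w \<and> u = w @ replicate (fst p) False)"
    by (simp only: dictionary_def set_concat set_map set_filter image_image UN_iff) blast
  also have "\<dots> \<longleftrightarrow> (\<exists>j E. (j, E) \<in> set (zip [0..<length es] es) \<and>
      (\<exists>w\<in>set ws. good E w \<and> u = w @ replicate j False))"
    unfolding Bex_def split_paired_Ex fst_conv snd_conv ..
  finally show ?thesis unfolding in_set_zip_upt by blast
qed

text \<open>The words of the last entity are longer than all words before them, whence the induction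
  from the end of the list.\<close>

lemma distinct_dictionary:
  assumes "distinct ws" "\<And>w. w \<in> set ws \<Longrightarrow> length w = l"
  shows "distinct (dictionary ws es)"
proof (induction es rule: rev_induct)
  case (snoc E es)
  have eq: "dictionary ws (es @ [E]) = dictionary ws es @
      map (\<lambda>w. w @ replicate (length es) False) (filter (good E) ws)"
    by (simp add: dictionary_def)
  have "length u < l + length es" if "u \<in> set (dictionary ws es)" for u
    using that assms(2) by (auto simp: set_dictionary)
  then have "set (dictionary ws es) \<inter> set (map (\<lambda>w. w @ replicate (length es) False) (filter (good E) ws)) = {}"
    using assms(2) by fastforce
  then show ?case
    unfolding eq using snoc assms(1) by (auto simp: distinct_map inj_on_def)
qed (simp add: dictionary_def)

text \<open>The link \<open>(v, a, b)\<close> requires rows \<open>a\<close> and \<open>b\<close> to agree on the variable \<open>v\<close>.\<close>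

definition ends :: "nat \<Rightarrow> (nat \<times> nat \<times> nat) list \<Rightarrow> nat" where
  "ends i rs = length (filter (\<lambda>r. fst (snd r) = i) rs) + length (filter (\<lambda>r. snd (snd r) = i) rs)"

lemma ends_append: "ends i (rs @ rs') = ends i rs + ends i rs'"
  by (simp add: ends_def)

text \<open>Each occurrence of row \<open>i\<close> in the list of a variable is the left partner of
  at most one link and the right partner of at most one, which gives the factor \<open>2\<close>;
  summing over the variables counts each occurrence once.\<close>

lemma ends_links: "ends i (links n occ) \<le> 2 * length (filter (\<lambda>p. snd p = i) occ)"
proof -
  have 1: "length (filter (\<lambda>p. fst p = i) (zip xs ys)) \<le> length (filter (\<lambda>x. x = i) xs)" for xs ys :: "nat list"
    by (induction xs arbitrary: ys) (auto simp: zip_Cons1 split: list.split)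
  have 2: "length (filter (\<lambda>p. snd p = i) (zip xs ys)) \<le> length (filter (\<lambda>x. x = i) ys)" for xs ys :: "nat list"
    by (induction ys arbitrary: xs) (auto simp: zip_Cons split: list.split)
  have tl: "length (filter P (tl xs)) \<le> length (filter P xs)" for P and xs :: "nat list"
    by (cases xs) auto
  have v: "ends i (map (\<lambda>p. (v, p)) (zip xs (tl xs))) \<le> 2 * length (filter (\<lambda>x. x = i) xs)" for v xs
    using 1[of xs "tl xs"] 2[of xs "tl xs"] tl[of "\<lambda>x. x = i" xs] by (simp add: ends_def filter_map o_def)
  have ro: "length (filter (\<lambda>x. x = i) (rows_of occ v)) = length (filter (\<lambda>p. fst p = v \<and> snd p = i) occ)" for v
    by (simp add: rows_of_def filter_map o_def conj_commute)
  have split: "length (filter (\<lambda>p. fst p < Suc n \<and> snd p = i) occ)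
      = length (filter (\<lambda>p. fst p < n \<and> snd p = i) occ) + length (filter (\<lambda>p. fst p = n \<and> snd p = i) occ)" for n
    by (induction occ) auto
  have "ends i (links n occ) \<le> 2 * length (filter (\<lambda>p. fst p < n \<and> snd p = i) occ)"
  proof (induction n)
    case (Suc n)
    have "links (Suc n) occ = links n occ @ map (\<lambda>p. (n, p)) (zip (rows_of occ n) (tl (rows_of occ n)))"
      by (simp add: links_def)
    then show ?case
      using Suc v[of n "rows_of occ n"] split[of n] ro[of n] by (simp add: ends_append)
  qed (simp add: links_def ends_def)
  also have "\<dots> \<le> 2 * length (filter (\<lambda>p. snd p = i) occ)"
    by (induction occ) auto
  finally show ?thesis .
qed

text \<open>Greedy colouring of the links by columns: each of the two rows of a link blocks at most
  \<open>m\<close> columns, so fewer than \<open>k\<close> are blocked. The last conjunct carries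
  the induction, since it ties the columns in use to the bound on link ends.\<close>

lemma placement_correct:
  assumes "\<And>i. ends i rs \<le> m" "2 * m < k"
  shows "(\<forall>x\<in>set (placement k rs). \<forall>y\<in>set (placement k rs). fst x = fst y \<longrightarrow> snd x = snd y) \<and>
    (\<forall>v a b. (v, a, b) \<in> set rs \<longrightarrow> (\<exists>s<k. ((a, s), v) \<in> set (placement k rs) \<and> ((b, s), v) \<in> set (placement k rs))) \<and>
    (\<forall>i. length (filter (\<lambda>y. fst (fst y) = i) (placement k rs)) = ends i rs)"
  using assms(1)
proof (induction rs rule: rev_induct)
  case Nil
  show ?case by (simp add: placement_def ends_def)
next
  case (snoc r rs)
  obtain v a b where r: "r = (v, a, b)" by (cases r)
  define acc where "acc = placement k rs"
  have le: "ends i rs \<le> m" for i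
    using snoc.prems[of i] by (simp add: ends_append)
  note IH = snoc.IH[OF le, folded acc_def]
  have func: "\<forall>x\<in>set acc. \<forall>y\<in>set acc. fst x = fst y \<longrightarrow> snd x = snd y"
    using IH by (rule conjunct1)
  have placed: "\<forall>v a b. (v, a, b) \<in> set rs \<longrightarrow> (\<exists>s<k. ((a, s), v) \<in> set acc \<and> ((b, s), v) \<in> set acc)"
    using IH[THEN conjunct2] by (rule conjunct1)
  have count: "\<forall>i. length (filter (\<lambda>y. fst (fst y) = i) acc) = ends i rs"
    using IH[THEN conjunct2] by (rule conjunct2)
  define used where "used i = (\<lambda>y. snd (fst y)) ` set (filter (\<lambda>y. fst (fst y) = i) acc)" for i
  have used: "card (used i) \<le> m" for i
  proof -
    have "card (used i) \<le> card (set (filter (\<lambda>y. fst (fst y) = i) acc))"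
      unfolding used_def by (rule card_image_le) simp
    also have "\<dots> \<le> length (filter (\<lambda>y. fst (fst y) = i) acc)" by (rule card_length)
    also have "\<dots> \<le> m" using count le by simp
    finally show ?thesis .
  qed
  have "card (used a \<union> used b) < card {..<k}"
    using card_Un_le[of "used a" "used b"] used[of a] used[of b] assms(2) by simp
  moreover have "finite (used a \<union> used b)" by (simp add: used_def)
  ultimately have "\<not> {..<k} \<subseteq> used a \<union> used b"
    using card_mono[of "used a \<union> used b" "{..<k}"] by linarith
  then obtain s where s: "s < k" "s \<notin> used a" "s \<notin> used b" by auto
  have "s \<in> set (free_columns k acc (a, b))"
    using s unfolding free_columns_def used_def by auto
  then obtain s' ss where s': "free_columns k acc (a, b) = s' # ss" by (cases "free_columns k acc (a, b)") auto
  then have "s' \<in> set (free_columns k acc (a, b))" by simp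
  then have s'': "s' < k" "\<And>y. y \<in> set acc \<Longrightarrow> snd (fst y) = s' \<Longrightarrow> fst (fst y) \<noteq> a \<and> fst (fst y) \<noteq> b"
    unfolding free_columns_def by auto
  have p: "placement k (rs @ [r]) = ((a, s'), v) # ((b, s'), v) # acc"
    by (simp add: placement_def acc_def[unfolded placement_def, symmetric] place_def r s')
  \<comment> \<open>The new reservations hit no earlier one, so a crossing never receives two
    variables. If \<open>a = b\<close>, the two new entries coincide.\<close>
  have new: "fst y \<noteq> (a, s') \<and> fst y \<noteq> (b, s')" if "y \<in> set acc" for y
    using s''(2)[OF that] by auto
  have "\<forall>x\<in>set (placement k (rs @ [r])). \<forall>y\<in>set (placement k (rs @ [r])). fst x = fst y \<longrightarrow> snd x = snd y"
  proof (intro ballI impI)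
    fix x y assume xy: "x \<in> set (placement k (rs @ [r]))" "y \<in> set (placement k (rs @ [r]))" "fst x = fst y"
    have "x = ((a, s'), v) \<or> x = ((b, s'), v) \<or> x \<in> set acc"
      "y = ((a, s'), v) \<or> y = ((b, s'), v) \<or> y \<in> set acc"
      using xy(1,2) unfolding p by simp_all
    then show "snd x = snd y"
      by (elim disjE) (use new[of x] new[of y] func[rule_format, of x y] xy(3) in simp_all)
  qed
  moreover have "\<exists>s<k. ((a', s), v') \<in> set (placement k (rs @ [r])) \<and> ((b', s), v') \<in> set (placement k (rs @ [r]))"
    if "(v', a', b') \<in> set (rs @ [r])" for v' a' b'
  proof (cases "(v', a', b') = r")
    case True
    then show ?thesis unfolding p using s''(1) by (auto simp: r)
  next
    case False
    then have "(v', a', b') \<in> set rs" using that by auto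
    with placed obtain s where "s < k" "((a', s), v') \<in> set acc" "((b', s), v') \<in> set acc" by blast
    then show ?thesis unfolding p by auto
  qed
  moreover have "length (filter (\<lambda>y. fst (fst y) = i) (placement k (rs @ [r]))) = ends i (rs @ [r])" for i
    unfolding p ends_append by (simp add: count) (simp add: ends_def r)
  ultimately show ?case by (intro conjI allI impI)
qed

lemma label_eq:
  assumes "\<forall>x\<in>set acc. \<forall>y\<in>set acc. fst x = fst y \<longrightarrow> snd x = snd y" "((i, s), v) \<in> set acc"
  shows "label n acc i s = v"
proof (cases "filter (\<lambda>p. fst (fst p) = i \<and> snd (fst p) = s) acc")
  case Nil
  with assms(2) show ?thesis by (auto simp: filter_empty_conv)
next
  case (Cons y ys)
  then have "y \<in> set (filter (\<lambda>p. fst (fst p) = i \<and> snd (fst p) = s) acc)" by simp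
  then have "y \<in> set acc" "fst y = (i, s)" by (auto simp: prod_eq_iff)
  then have "snd y = v" using assms(1)[rule_format, of y "((i, s), v)"] assms(2) by simp
  with Cons show ?thesis by (simp add: label_def)
qed

text \<open>Transfers agreement along consecutive links to agreement of every row of a variable with
  its first row.\<close>

lemma chain_constant:
  assumes "\<And>a b. (a, b) \<in> set (zip xs (tl xs)) \<Longrightarrow> f a = f b" "x \<in> set xs"
  shows "f x = f (hd xs)"
  using assms
proof (induction xs arbitrary: x)
  case (Cons y ys)
  show ?case
  proof (cases "x = y")
    case False
    then have x: "x \<in> set ys" using Cons.prems(2) by auto
    then obtain z zs where ys: "ys = z # zs" by (cases ys) auto
    have "f x = f (hd ys)"
      by (rule Cons.IH[OF _ x]) (use Cons.prems(1) ys in auto)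
    also have "\<dots> = f y" using Cons.prems(1)[of y z] ys by simp
    finally show ?thesis by simp
  qed simp
qed simp

lemma zip_map_self: "length ls \<le> length w \<Longrightarrow> (\<forall>j<length ls. w ! j = \<alpha> (ls ! j)) \<Longrightarrow> zip ls w = map (\<lambda>v. (v, \<alpha> v)) ls"
  by (rule nth_equalityI) auto

section \<open>From tuples to crossword instances\<close>

definition row_slot :: "nat \<Rightarrow> nat \<Rightarrow> slot" where
  "row_slot l i = \<lparr>orient = Horizontal, start_row = i, start_col = 0, slot_len = l + i\<rparr>"

definition column_slot :: "nat \<Rightarrow> nat \<Rightarrow> nat \<Rightarrow> slot" where
  "column_slot l q s = \<lparr>orient = Vertical, start_row = 0, start_col = s, slot_len = l + q + s\<rparr>"

lemma cell_at_slots [simp]: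
  "cell_at (row_slot l i) j = (i, j)" "cell_at (column_slot l q s) j = (j, s)"
  by (auto simp: row_slot_def column_slot_def)

declare cell_at.simps [simp del]

lemma slot_len_slots [simp]: "slot_len (row_slot l i) = l + i" "slot_len (column_slot l q s) = l + q + s"
  by (auto simp: row_slot_def column_slot_def)

lemma orient_slots [simp]: "orient (row_slot l i) = Horizontal" "orient (column_slot l q s) = Vertical"
  by (auto simp: row_slot_def column_slot_def)

definition mk_slot :: "bool \<times> nat \<times> nat \<times> nat \<Rightarrow> slot" where
  "mk_slot = (\<lambda>(b, r, c, l). \<lparr>orient = if b then Vertical else Horizontal, start_row = r, start_col = c, slot_len = l\<rparr>)"

definition mk_crossword :: "bool list list \<times> nat \<times> nat \<times> (bool \<times> nat \<times> nat \<times> nat) list \<Rightarrow> bool crossword" where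
  "mk_crossword = (\<lambda>(d, h, w, ss). \<lparr>dict = d, height = h, width = w, slots = map mk_slot ss\<rparr>)"

text \<open>The computed tuple has literally the code of the instance, so the output of the
  reduction can be handed to the solver without conversion.\<close>

lemma enc_mk_crossword:
  "enc_crossword (mk_crossword t) = enc_pair enc_words (enc_pair enc_nat (enc_pair enc_nat enc_slots)) t"
proof -
  have "enc_slot (mk_slot t) = enc_pair enc_bool (enc_pair enc_nat (enc_pair enc_nat enc_nat)) t" for t
    by (cases t) (simp add: mk_slot_def)
  then have "enc_list enc_slot (map mk_slot ss) = enc_slots ss" for ss
    by (induction ss) auto
  then show ?thesis
    by (cases t) (simp add: enc_crossword_def mk_crossword_def)
qed

locale reduction =
  fixes n q :: nat and cls :: "literal list list"
  assumes size: "length cls \<le> q * q"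
    and three: "\<And>c. c \<in> set cls \<Longrightarrow> length c \<le> 3"
    and bound: "\<And>c v b. c \<in> set cls \<Longrightarrow> (v, b) \<in> set c \<Longrightarrow> v < n"
begin

definition "k = 12 * q + 1"
definition "l = k + 3 * q"
definition "occ = occurrences q cls"
definition "acc = placement k (links n occ)"
definition "lab = label n acc"
definition "rowE i = row_entity n q k cls acc i"
definition "colE s = column_entity n q acc s"
definition "es = map rowE [0..<q] @ map colE [0..<k]"
definition "I = mk_crossword (crossword_data (bitlists l) n cls q)"

lemma slots_I: "slots I = map (row_slot l) [0..<q] @ map (column_slot l q) [0..<k]"
  unfolding I_def mk_crossword_def crossword_data_def Let_def slot_data_def
    k_def[symmetric] l_def[symmetric]
  by (simp add: mk_slot_def row_slot_def column_slot_def o_def)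

lemma dims_I: "height I = l + q + k" "width I = l + q + k"
  by (simp_all add: I_def mk_crossword_def crossword_data_def Let_def l_def k_def)

lemma dict_I: "dict I = dictionary (bitlists l) es"
  unfolding I_def mk_crossword_def crossword_data_def Let_def es_def rowE_def colE_def acc_def occ_def l_def k_def
  by simp

lemma length_es: "length es = q + k"
  by (simp add: es_def)

lemma es_nth: "i < q \<Longrightarrow> es ! i = rowE i" "s < k \<Longrightarrow> es ! (q + s) = colE s"
  by (simp_all add: es_def nth_append)

lemma slots_cases:
  assumes "S \<in> set (slots I)"
  obtains (row) i where "i < q" "S = row_slot l i" | (column) s where "s < k" "S = column_slot l q s"
  using assms by (auto simp: slots_I)

lemma row_slot_in: "i < q \<Longrightarrow> row_slot l i \<in> set (slots I)"
  and column_slot_in: "s < k \<Longrightarrow> column_slot l q s \<in> set (slots I)"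
  by (auto simp: slots_I)

text \<open>Row \<open>i\<close> and column \<open>s\<close> meet at letter \<open>s < k\<close> of
  the row and letter \<open>i < q\<close> of the column. Both lie among the first \<open>l\<close>
  letters, so paddings never meet a crossing.\<close>

lemma k_le_l: "k \<le> l" "q \<le> l" "0 < l"
  by (auto simp: l_def k_def)

lemma distinct_sizes: "distinct_slot_sizes I"
  unfolding distinct_slot_sizes_def by (rule inj_onI) (auto elim!: slots_cases)

lemma num_slots_I: "num_slots I = 13 * q + 1"
  by (simp add: num_slots_def slots_I k_def)

lemma valid: "valid_crossword I"
  unfolding valid_crossword_def
proof (intro conjI ballI impI)
  show "distinct (dict I)"
    unfolding dict_I by (rule distinct_dictionary[where l = l]) (auto simp: distinct_bitlists set_bitlists)
  have "distinct (map slot_len (slots I))"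
  proof -
    have "map slot_len (slots I) = map (\<lambda>i. l + i) [0..<q] @ map (\<lambda>s. l + q + s) [0..<k]"
      by (simp add: slots_I o_def)
    then show ?thesis by (auto simp: distinct_map inj_on_def)
  qed
  then show "distinct (slots I)" by (simp add: distinct_map)
next
  fix S assume S: "S \<in> set (slots I)"
  then show "0 < slot_len S" using k_le_l by (cases rule: slots_cases) auto
  from S show "cells S \<subseteq> {..<height I} \<times> {..<width I}"
    by (cases rule: slots_cases) (auto simp: cells_def dims_I)
next
  fix S T assume ST: "S \<in> set (slots I)" "T \<in> set (slots I)" "S \<noteq> T \<and> orient S = orient T"
  from ST(1,2) show "cells S \<inter> cells T = {}"
    by (elim slots_cases) (use ST(3) in \<open>auto simp: cells_def\<close>)
qed

lemma row_clauses_subset: "set (row_clauses q cls i) \<subseteq> set cls"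
  unfolding row_clauses_def by (meson set_drop_subset set_take_subset subset_trans)

lemma length_vars_row: "length (vars (row_clauses q cls i)) \<le> 3 * q"
proof -
  have *: "length (concat cs) \<le> 3 * length cs" if "\<forall>c\<in>set cs. length c \<le> 3" for cs :: "literal list list"
    using that by (induction cs) auto
  have "length (concat (row_clauses q cls i)) \<le> 3 * length (row_clauses q cls i)"
    using three row_clauses_subset by (intro *) blast
  also have "\<dots> \<le> 3 * q" by (simp add: row_clauses_def)
  finally show ?thesis by (simp add: vars_def)
qed

lemma set_occ: "(v, i) \<in> set occ \<longleftrightarrow> i < q \<and> v \<in> set (vars (row_clauses q cls i))"
proof -
  have "set occ = (\<Union>j\<in>{0..<q}. (\<lambda>v. (v, j)) ` set (vars (row_clauses q cls j)))"
    by (simp add: occ_def occurrences_def)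
  then show ?thesis by auto
qed

lemma occ_row: "length (filter (\<lambda>p. snd p = i) occ) \<le> 3 * q"
proof -
  have "length (filter (\<lambda>p. snd p = i) (concat (map (\<lambda>j. map (\<lambda>v. (v, j)) (f j)) [0..<m])))
      = (if i < m then length (f i) else 0)" for f :: "nat \<Rightarrow> nat list" and m
  proof (induction m)
    case (Suc m)
    have "filter (\<lambda>p. snd p = i) (map (\<lambda>v. (v, m)) (f m)) = (if m = i then map (\<lambda>v. (v, m)) (f m) else [])"
      by (auto simp: filter_map o_def)
    with Suc show ?case by (cases "m = i") (simp_all add: less_Suc_eq)
  qed simp
  then show ?thesis
    unfolding occ_def occurrences_def using length_vars_row[of i] by simp
qed

end

lemma good_consistent:
  assumes "good E w" "(v, b) \<in> set (zip (fst E) w)" "(v, b') \<in> set (zip (fst E) w)"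
  shows "b = b'"
proof -
  have "\<forall>y\<in>set (zip (fst E) w). \<forall>z\<in>set (zip (fst E) w). fst y = fst z \<longrightarrow> snd y = snd z"
    using assms(1) unfolding good_def by (rule conjunct1)
  from this[rule_format, OF assms(2,3)] show ?thesis by simp
qed

lemma good_clause:
  assumes "good E w" "c \<in> set (snd E)"
  obtains v b where "(v, b) \<in> set c" "(v, b) \<in> set (zip (fst E) w)"
proof -
  have "\<forall>c\<in>set (snd E). \<exists>l\<in>set c. \<exists>y\<in>set (zip (fst E) w). fst y = fst l \<and> snd y = snd l"
    using assms(1) unfolding good_def by (rule conjunct2)
  then obtain l y where "l \<in> set c" "y \<in> set (zip (fst E) w)" "fst y = fst l \<and> snd y = snd l"
    using assms(2) by blast
  then show thesis using that[of "fst l" "snd l"] prod_eqI[of y l] by simp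
qed

lemma set_links: "(v, a, b) \<in> set (links n occ) \<longleftrightarrow>
    v < n \<and> (a, b) \<in> set (zip (rows_of occ v) (tl (rows_of occ v)))"
  by (auto simp: links_def)

context reduction
begin

text \<open>Combines the degree bound \<open>6 * q\<close> with the choice of \<open>k\<close>,
  which exceeds twice that bound by one.\<close>

lemma links_placed:
  assumes "(v, a, b) \<in> set (links n occ)"
  shows "\<exists>s<k. lab a s = v \<and> lab b s = v"
proof -
  have "ends i (links n occ) \<le> 6 * q" for i
    using ends_links[of i n occ] occ_row[of i] by linarith
  moreover have "2 * (6 * q) < k" by (simp add: k_def)
  ultimately have "(\<forall>x\<in>set acc. \<forall>y\<in>set acc. fst x = fst y \<longrightarrow> snd x = snd y) \<and>
      (\<forall>v a b. (v, a, b) \<in> set (links n occ) \<longrightarrow> (\<exists>s<k. ((a, s), v) \<in> set acc \<and> ((b, s), v) \<in> set acc)) \<and>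
      (\<forall>i. length (filter (\<lambda>y. fst (fst y) = i) acc) = ends i (links n occ))"
    unfolding acc_def by (rule placement_correct)
  then have func: "\<forall>x\<in>set acc. \<forall>y\<in>set acc. fst x = fst y \<longrightarrow> snd x = snd y"
    and placed: "\<forall>v a b. (v, a, b) \<in> set (links n occ) \<longrightarrow> (\<exists>s<k. ((a, s), v) \<in> set acc \<and> ((b, s), v) \<in> set acc)"
    by (rule conjunct1, elim conjE)
  from placed assms obtain s where s: "s < k" "((a, s), v) \<in> set acc" "((b, s), v) \<in> set acc" by blast
  show ?thesis
    unfolding lab_def using label_eq[OF func s(2)] label_eq[OF func s(3)] s(1) by blast
qed

text \<open>Clause number \<open>j\<close> lies in block \<open>j div q\<close>, and
  \<open>length cls \<le> q * q\<close> makes this block one of the \<open>q\<close> rows.\<close>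

lemma row_of_clause:
  assumes "c \<in> set cls"
  obtains i where "i < q" "c \<in> set (row_clauses q cls i)"
proof -
  obtain j where j: "j < length cls" "c = cls ! j" using assms by (auto simp: in_set_conv_nth)
  then have jq: "j < q * q" using size by linarith
  then have q: "0 < q" by (cases q) auto
  have jd: "j div q < q" using jq by (simp add: less_mult_imp_div_less)
  have jj: "j div q * q + j mod q = j" by simp
  have le: "j div q * q \<le> length cls" using jj j(1) by linarith
  have "row_clauses q cls (j div q) ! (j mod q) = c"
    using j(2) q le jj by (simp add: row_clauses_def del: div_mult_mod_eq)
  moreover have "j mod q < length (row_clauses q cls (j div q))"
  proof -
    have "j mod q < length cls - j div q * q" using j(1) jj by linarith
    then show ?thesis using q by (simp add: row_clauses_def)
  qed
  ultimately have "c \<in> set (row_clauses q cls (j div q))" by (metis nth_mem)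
  then show thesis by (rule that[OF jd])
qed

text \<open>The unpadded part always has length \<open>l\<close>, so the total length determines the
  padding and with it the entity.\<close>

lemma dict_word:
  assumes "u \<in> set (dict I)" "length u = l + j"
  obtains w where "length w = l" "good (es ! j) w" "u = w @ replicate j False"
  using assms by (auto simp: dict_I set_dictionary set_bitlists)

section \<open>From a filling to a satisfying assignment\<close>

lemma fillable_imp_satisfiable:
  assumes "completely_fillable I"
  shows "\<exists>\<alpha>. \<forall>c\<in>set cls. \<exists>(v, b)\<in>set c. \<alpha> v = b"
proof -
  obtain f where f: "feasible I f" "\<forall>S\<in>set (slots I). f S \<noteq> None"
    using assms unfolding completely_fillable_def by blast
  have "\<exists>w. length w = l \<and> good (rowE i) w \<and> f (row_slot l i) = Some (w @ replicate i False)" if i: "i < q" for i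
  proof -
    obtain u where u: "f (row_slot l i) = Some u" using f(2) row_slot_in[OF i] by blast
    then have "u \<in> set (dict I)" "length u = l + i"
      using f(1) row_slot_in[OF i] unfolding feasible_def by fastforce+
    then show ?thesis using dict_word u es_nth(1)[OF i] by metis
  qed
  then obtain w where w: "\<And>i. i < q \<Longrightarrow> length (w i) = l" "\<And>i. i < q \<Longrightarrow> good (rowE i) (w i)"
    "\<And>i. i < q \<Longrightarrow> f (row_slot l i) = Some (w i @ replicate i False)" by metis
  have "\<exists>x. length x = l \<and> good (colE s) x \<and> f (column_slot l q s) = Some (x @ replicate (q + s) False)" if s: "s < k" for s
  proof -
    obtain u where u: "f (column_slot l q s) = Some u" using f(2) column_slot_in[OF s] by blast
    then have "u \<in> set (dict I)" "length u = l + (q + s)"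
      using f(1) column_slot_in[OF s] unfolding feasible_def by fastforce+
    then show ?thesis using dict_word u es_nth(2)[OF s] by metis
  qed
  then obtain x where x: "\<And>s. s < k \<Longrightarrow> length (x s) = l" "\<And>s. s < k \<Longrightarrow> good (colE s) (x s)"
    "\<And>s. s < k \<Longrightarrow> f (column_slot l q s) = Some (x s @ replicate (q + s) False)" by metis
  have cross: "w i ! s = x s ! i" if "i < q" "s < k" for i s
  proof -
    have "\<forall>i'<slot_len (row_slot l i). \<forall>j<slot_len (column_slot l q s).
        cell_at (row_slot l i) i' = cell_at (column_slot l q s) j \<longrightarrow>
        (w i @ replicate i False) ! i' = (x s @ replicate (q + s) False) ! j"
      using f(1) row_slot_in[OF that(1)] column_slot_in[OF that(2)] w(3)[OF that(1)] x(3)[OF that(2)]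
      unfolding feasible_def by blast
    then have "(w i @ replicate i False) ! s = (x s @ replicate (q + s) False) ! i"
      using that k_le_l by auto
    then show ?thesis using that k_le_l w(1) x(1) by (simp add: nth_append)
  qed
  \<comment> \<open>\<open>\<beta> i\<close> is the assignment read off row \<open>i\<close>, with
    \<open>False\<close> for variables that label no cell of the row. Consistency of the word makes
    it independent of the cell chosen.\<close>
  define \<beta> where "\<beta> i v \<longleftrightarrow> (v, True) \<in> set (zip (fst (rowE i)) (w i))" for i v
  have \<beta>: "\<beta> i v = b" if "i < q" "(v, b) \<in> set (zip (fst (rowE i)) (w i))" for i v b
    using that(2) good_consistent[OF w(2)[OF that(1)] that(2), of True] unfolding \<beta>_def by (cases b) auto
  have \<beta>lab: "\<beta> i (lab i s) = w i ! s" if "i < q" "s < k" for i s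
  proof (rule \<beta>[OF that(1)])
    have "fst (rowE i) ! s = lab i s" "s < length (fst (rowE i))"
      using that(2) by (simp_all add: rowE_def row_entity_def lab_def nth_append)
    then show "(lab i s, w i ! s) \<in> set (zip (fst (rowE i)) (w i))"
      using that k_le_l w(1) by (auto simp: in_set_zip intro!: exI[of _ s])
  qed
  \<comment> \<open>The value travels from row \<open>a\<close> through the column reserved for
    \<open>v\<close> to row \<open>b\<close>: the column's word carries equal letters at its two
    crossings labelled \<open>v\<close>.\<close>
  have link: "\<beta> a v = \<beta> b v" if ab: "(v, a, b) \<in> set (links n occ)" for v a b
  proof -
    obtain s where s: "s < k" "lab a s = v" "lab b s = v" using links_placed[OF ab] by blast
    have "(a, b) \<in> set (zip (rows_of occ v) (tl (rows_of occ v)))" using ab by (simp add: set_links)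
    then have "a \<in> set (rows_of occ v)" "b \<in> set (tl (rows_of occ v))"
      by (rule set_zip_leftD, rule set_zip_rightD)
    then have "a \<in> set (rows_of occ v)" "b \<in> set (rows_of occ v)"
      by (simp_all add: list.set_sel(2)) (cases "rows_of occ v"; simp)
    then have q: "a < q" "b < q" by (auto simp: rows_of_def set_occ)
    have "(lab i s, x s ! i) \<in> set (zip (fst (colE s)) (x s))" if "i < q" for i
      using that x(1)[OF s(1)] k_le_l
      by (auto simp: in_set_zip colE_def column_entity_def lab_def intro!: exI[of _ i])
    from this[OF q(1)] this[OF q(2)] have "x s ! a = x s ! b"
      unfolding s(2,3) by (rule good_consistent[OF x(2)[OF s(1)]])
    then show ?thesis using \<beta>lab[of a s] \<beta>lab[of b s] cross q s by auto
  qed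
  \<comment> \<open>The value is taken from the first row containing \<open>v\<close>; for a
    variable without occurrence it is arbitrary.\<close>
  define \<alpha> where "\<alpha> v = \<beta> (hd (rows_of occ v)) v" for v
  have \<alpha>: "\<alpha> v = \<beta> i v" if "(v, i) \<in> set occ" "v < n" for v i
  proof -
    have "i \<in> set (rows_of occ v)" using that(1) by (force simp: rows_of_def)
    moreover have "\<beta> a v = \<beta> b v" if "(a, b) \<in> set (zip (rows_of occ v) (tl (rows_of occ v)))" for a b
      by (rule link) (simp add: set_links that \<open>v < n\<close>)
    ultimately show ?thesis
      unfolding \<alpha>_def using chain_constant[of "rows_of occ v" "\<lambda>i. \<beta> i v" i] by simp
  qed
  have "\<exists>(v, b)\<in>set c. \<alpha> v = b" if c: "c \<in> set cls" for c
  proof -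
    obtain i where i: "i < q" "c \<in> set (row_clauses q cls i)" using c by (rule row_of_clause)
    have "c \<in> set (snd (rowE i))" using i(2) by (simp add: rowE_def row_entity_def)
    from good_clause[OF w(2)[OF i(1)] this] obtain v b where vb: "(v, b) \<in> set c" "(v, b) \<in> set (zip (fst (rowE i)) (w i))" .
    have "v \<in> set (vars (row_clauses q cls i))"
      using i(2) vb(1) by (force simp: vars_def)
    then have "\<alpha> v = \<beta> i v" using i(1) bound[OF c vb(1)] by (intro \<alpha>) (simp add: set_occ)
    also have "\<dots> = b" by (rule \<beta>[OF i(1) vb(2)])
    finally show ?thesis using vb(1) by blast
  qed
  then show ?thesis by blast
qed

section \<open>From a satisfying assignment to a filling\<close>

lemma satisfiable_imp_fillable:
  assumes \<alpha>: "\<forall>c\<in>set cls. \<exists>(v, b)\<in>set c. \<alpha> v = b"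
  shows "completely_fillable I"
proof -
  \<comment> \<open>Every labelled cell receives the value of its label; \<open>False\<close> fills
    the rest up to length \<open>l\<close>, and then comes the padding.\<close>
  define W where "W j = (map \<alpha> (fst (es ! j)) @ replicate (l - length (fst (es ! j))) False) @ replicate j False" for j
  have column: "\<exists>s<k. j = q + s" if "j < q + k" "\<not> j < q" for j
    by (rule exI[of _ "j - q"]) (use that in linarith)
  have len: "length (fst (es ! j)) \<le> l" if "j < q + k" for j
  proof (cases "j < q")
    case True
    then show ?thesis using length_vars_row[of j] by (simp add: es_nth rowE_def row_entity_def l_def)
  next
    case False
    then obtain s where "j = q + s" "s < k" using column[OF \<open>j < q + k\<close>] by blast
    then show ?thesis using k_le_l by (simp add: es_nth colE_def column_entity_def)
  qed
  have W: "W j \<in> set (dict I)" "length (W j) = l + j" if j: "j < q + k" for j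
  proof -
    let ?ls = "fst (es ! j)"
    let ?w = "map \<alpha> ?ls @ replicate (l - length ?ls) False"
    have z: "zip ?ls ?w = map (\<lambda>v. (v, \<alpha> v)) ?ls"
      by (rule zip_map_self) (auto simp: nth_append)
    have lw: "length ?w = l" using len[OF j] by simp
    have "\<exists>y\<in>set c. fst y \<in> set ?ls \<and> \<alpha> (fst y) = snd y" if c: "c \<in> set (snd (es ! j))" for c
    proof (cases "j < q")
      case True
      then have c': "c \<in> set (row_clauses q cls j)" using c by (simp add: es_nth rowE_def row_entity_def)
      then obtain v b where vb: "(v, b) \<in> set c" "\<alpha> v = b" using \<alpha> row_clauses_subset by blast
      then have "v \<in> set (vars (row_clauses q cls j))" using c' by (force simp: vars_def)
      then have "v \<in> set ?ls" using True by (simp add: es_nth rowE_def row_entity_def)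
      then show ?thesis using vb by (intro bexI[of _ "(v, b)"]) simp_all
    next
      case False
      then obtain s where "j = q + s" "s < k" using column[OF j] by blast
      then show ?thesis using c by (simp add: es_nth colE_def column_entity_def)
    qed
    then have "\<forall>c\<in>set (snd (es ! j)). \<exists>y\<in>set c. \<exists>z\<in>set (map (\<lambda>v. (v, \<alpha> v)) ?ls). fst z = fst y \<and> snd z = snd y"
      by auto
    moreover have "\<forall>y\<in>set (map (\<lambda>v. (v, \<alpha> v)) ?ls). \<forall>z\<in>set (map (\<lambda>v. (v, \<alpha> v)) ?ls). fst y = fst z \<longrightarrow> snd y = snd z"
      by auto
    ultimately have "good (es ! j) ?w" unfolding good_def z by (intro conjI)
    then show "W j \<in> set (dict I)" "length (W j) = l + j"
      using lw j unfolding W_def dict_I set_dictionary set_bitlists length_es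
      by (blast, simp)
  qed
  have cross: "W i ! s = W (q + s) ! i" if "i < q" "s < k" for i s
  proof -
    have "W i ! s = \<alpha> (lab i s)"
      using that by (simp add: W_def es_nth rowE_def row_entity_def nth_append lab_def)
    moreover have "W (q + s) ! i = \<alpha> (lab i s)"
      using that by (simp add: W_def es_nth colE_def column_entity_def nth_append lab_def)
    ultimately show ?thesis by simp
  qed
  define f where "f S = Some (W (if orient S = Horizontal then start_row S else q + start_col S))" for S :: slot
  have f: "f (row_slot l i) = Some (W i)" "f (column_slot l q s) = Some (W (q + s))" for i s
    by (simp_all add: f_def row_slot_def column_slot_def)
  have "feasible I f"
    unfolding feasible_def
  proof (intro conjI ballI allI impI)
    fix S w assume "S \<in> set (slots I)" "f S = Some w"
    then show "w \<in> set (dict I)" "length w = slot_len S"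
      using W by (auto elim!: slots_cases simp: f)
  next
    fix S T u v i j
    assume ST: "S \<in> set (slots I)" "T \<in> set (slots I)" and uv: "f S = Some u" "f T = Some v"
      and cell: "cell_at S i = cell_at T j"
    from ST(1) show "u ! i = v ! j"
    proof (cases rule: slots_cases)
      case S: (row a)
      from ST(2) show ?thesis
      proof (cases rule: slots_cases)
        case (row b)
        with S uv cell show ?thesis by (simp add: f)
      next
        case (column s)
        with S uv cell show ?thesis using cross[of a s] by (simp add: f)
      qed
    next
      case S: (column s)
      from ST(2) show ?thesis
      proof (cases rule: slots_cases)
        case (row b)
        with S uv cell show ?thesis using cross[of b s] by (simp add: f)
      next
        case (column b)
        with S uv cell show ?thesis by (simp add: f)
      qed
    qed
  qed
  then show ?thesis unfolding completely_fillable_def by (auto simp: f_def)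
qed

end

subsection \<open>Running time\<close>

text \<open>If the square of the count \<open>q\<close> were below \<open>m\<close>, all
  \<open>q + 1\<close> numbers up to \<open>q\<close> would have been counted.\<close>

lemma le_ceil_sqrt_square: "m \<le> ceil_sqrt m * ceil_sqrt m"
proof (rule ccontr)
  define q where "q = ceil_sqrt m"
  assume "\<not> m \<le> ceil_sqrt m * ceil_sqrt m"
  then have q: "q * q < m" by (simp add: q_def)
  have "j < m \<and> j * j < m" if "j \<le> q" for j
  proof -
    have "j * j \<le> q * q" using that by (intro mult_mono) auto
    moreover have "j \<le> j * j" by (cases j) auto
    ultimately show ?thesis using q by linarith
  qed
  then have "{..q} \<subseteq> {j. j < m \<and> j * j < m}" by auto
  then have "card {..q} \<le> card {j. j < m \<and> j * j < m}"
    by (intro card_mono) auto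
  also have "{j. j < m \<and> j * j < m} = set (filter (\<lambda>j. j * j < m) [0..<m])" by auto
  also have "card \<dots> = q"
    unfolding q_def ceil_sqrt_def by (rule distinct_card) simp
  finally show False by simp
qed

text \<open>Counted numbers lie below the root; were the root below \<open>q - 1\<close>, at most
  \<open>q - 1\<close> numbers would have been counted.\<close>

lemma ceil_sqrt_le: "real (ceil_sqrt m) \<le> sqrt (real m) + 1"
proof (rule ccontr)
  define q where "q = ceil_sqrt m"
  assume "\<not> real (ceil_sqrt m) \<le> sqrt (real m) + 1"
  then have q: "sqrt (real m) < real q - 1" by (simp add: q_def)
  have "set (filter (\<lambda>j. j * j < m) [0..<m]) \<subseteq> {..<q - 1}"
  proof
    fix j assume "j \<in> set (filter (\<lambda>j. j * j < m) [0..<m])"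
    then have "real (j * j) < real m" by (simp only: set_filter mem_Collect_eq of_nat_less_iff)
    then have "(real j)\<^sup>2 < real m" by (simp add: power2_eq_square)
    then have "real j < sqrt (real m)" by (rule real_less_rsqrt)
    then show "j \<in> {..<q - 1}" using q by simp
  qed
  then have "card (set (filter (\<lambda>j. j * j < m) [0..<m])) \<le> card {..<q - 1}"
    by (intro card_mono) auto
  moreover have "card (set (filter (\<lambda>j. j * j < m) [0..<m])) = q"
    unfolding q_def ceil_sqrt_def by (rule distinct_card) simp
  ultimately have "q \<le> q - 1" by simp
  moreover have "0 < q"
  proof -
    have "0 \<le> sqrt (real m)" by simp
    with q have "0 < real q" by linarith
    then show ?thesis by simp
  qed
  ultimately show False by simp
qed

section \<open>Cost of the reduction\<close>

abbreviation "enc_formula \<equiv> enc_pair enc_nat enc_clauses"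
abbreviation "enc_instance \<equiv> enc_pair enc_words (enc_pair enc_nat (enc_pair enc_nat enc_slots))"

text \<open>The value of \<open>l\<close> in the reduction: \<open>12 * q + 1\<close> crossings and
  room for \<open>3 * q\<close> literals.\<close>

definition word_length :: "literal list list \<Rightarrow> nat" where
  "word_length cls = 15 * ceil_sqrt (length cls) + 1"

definition reduce :: "nat \<times> literal list list \<Rightarrow> bool list list \<times> nat \<times> nat \<times> (bool \<times> nat \<times> nat \<times> nat) list" where
  "reduce \<phi> = crossword_data (bitlists (word_length (snd \<phi>))) (fst \<phi>) (snd \<phi>) (ceil_sqrt (length (snd \<phi>)))"

text \<open>Input size plus the number of candidate words: the budget for the reduction.\<close>

definition resource :: "nat \<times> literal list list \<Rightarrow> nat" where
  "resource \<phi> = data_size (enc_formula \<phi>) + 2 ^ word_length (snd \<phi>)"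

lemma ptime_reduce: "ptime_in resource enc_formula enc_instance reduce"
proof -
  have size: "polybd resource (\<lambda>x. data_size (enc_formula x))"
    by (rule polybd_mono[OF polybd_self]) (simp add: resource_def)
  have pow: "polybd resource (\<lambda>x. 2 ^ word_length (snd x))"
    by (rule polybd_mono[OF polybd_self]) (simp add: resource_def)
  note id = ptime_in_id[OF size]
  have q: "ptime_in resource enc_formula enc_nat (\<lambda>x. ceil_sqrt (length (snd x)))"
    by (rule id pt)+
  have "ptime enc_nat enc_nat (\<lambda>q. 15 * q + 1)" by (rule pt)+
  from ptime_in_comp[OF q this]
  have "ptime_in resource enc_formula enc_nat (\<lambda>x. word_length (snd x))"
    by (simp add: word_length_def)
  then have "ptime_in resource enc_formula enc_words (\<lambda>x. bitlists (word_length (snd x)))"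
    using pow by (rule ptime_in_bitlists)
  then have "ptime_in resource enc_formula (enc_pair enc_words (enc_pair enc_nat (enc_pair enc_clauses enc_nat)))
      (\<lambda>x. (bitlists (word_length (snd x)), fst x, snd x, ceil_sqrt (length (snd x))))"
    by - (assumption | rule q id pt)+
  from ptime_in_comp[OF this ptime_crossword_data]
  show ?thesis by (simp add: reduce_def[abs_def])
qed

lemma data_size_enc_list_le:
  "\<forall>x\<in>set xs. data_size (f x) \<le> b \<Longrightarrow> data_size (enc_list f xs) \<le> 1 + length xs * (b + 1)"
  by (induction xs) auto

lemma enc_cnf_eq: "enc_cnf \<phi> = enc_formula (num_vars \<phi>, clauses \<phi>)"
  by (simp add: enc_cnf_def enc_pair_def)

text \<open>Each of the at most three literals of a clause costs linearly in the number of variables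
  because of unary indices, whence the square.\<close>

lemma data_size_enc_cnf:
  assumes "is_3cnf \<phi>"
  shows "data_size (enc_cnf \<phi>) \<le> 20 * (num_vars \<phi> + num_clauses \<phi> + 1)\<^sup>2"
proof -
  define n m where "n = num_vars \<phi>" and "m = num_clauses \<phi>"
  have lit: "data_size (enc_pair enc_nat enc_bool l) \<le> 2 * n + 5" if "c \<in> set (clauses \<phi>)" "l \<in> set c" for c l
  proof -
    obtain v b where l: "l = (v, b)" by (cases l)
    then have "v < n" using assms that unfolding is_3cnf_def n_def by blast
    then show ?thesis using data_size_enc_bool[of b] by (simp add: l)
  qed
  have "data_size (enc_list (enc_pair enc_nat enc_bool) c) \<le> 6 * n + 19" if c: "c \<in> set (clauses \<phi>)" for c
  proof -
    have "data_size (enc_list (enc_pair enc_nat enc_bool) c) \<le> 1 + length c * (2 * n + 5 + 1)"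
      by (rule data_size_enc_list_le) (use lit[OF c] in blast)
    also have "length c * (2 * n + 5 + 1) \<le> 3 * (2 * n + 5 + 1)"
      using assms c unfolding is_3cnf_def by (intro mult_right_mono) auto
    finally show ?thesis by simp
  qed
  then have "data_size (enc_clauses (clauses \<phi>)) \<le> 1 + length (clauses \<phi>) * (6 * n + 19 + 1)"
    by (intro data_size_enc_list_le) blast
  then have "data_size (enc_cnf \<phi>) \<le> 2 * n + 3 + m * (6 * n + 20)"
    by (simp add: enc_cnf_eq n_def m_def num_clauses_def add.commute)
  also have "\<dots> \<le> 20 * (n + m + 1)\<^sup>2"
    by (simp add: power2_eq_square algebra_simps)
  finally show ?thesis by (simp add: n_def m_def)
qed

text \<open>Follows from \<open>t \<le> exp (t - 1)\<close> at \<open>t = x * ln 2\<close>: the loss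
  in replacing \<open>x\<close> by \<open>x * ln 2\<close> is at most a factor \<open>2\<close>,
  which \<open>exp 1\<close> makes up for.\<close>

lemma le_two_powr: "0 \<le> x \<Longrightarrow> x \<le> 2 powr x" for x :: real
proof -
  assume x: "0 \<le> x"
  have "x \<le> 2 * (x * ln 2)"
    using mult_left_mono[OF ln2_ge_two_thirds x] x by simp
  also have "\<dots> \<le> exp 1 * exp (x * ln 2 - 1)"
  proof (rule mult_mono)
    show "(2::real) \<le> exp 1" using exp_ge_add_one_self[of 1] by simp
    show "x * ln 2 \<le> exp (x * ln 2 - 1)" using exp_ge_add_one_self[of "x * ln 2 - 1"] by simp
  qed (use x in simp_all)
  also have "\<dots> = 2 powr x" by (simp add: powr_def flip: exp_add)
  finally show "x \<le> 2 powr x" .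
qed

text \<open>The budget is exponential only in the square root of the formula's parameters, so
  constant powers of it stay subexponential.\<close>

lemma resource_le:
  assumes "is_3cnf \<phi>"
  defines "y \<equiv> sqrt (real (num_vars \<phi> + num_clauses \<phi>))"
  shows "real (resource (num_vars \<phi>, clauses \<phi>) + 2) \<le> 2 powr (17 * (y + 1))"
proof -
  define N where "N = num_vars \<phi> + num_clauses \<phi>"
  have y: "0 \<le> y" "y\<^sup>2 = real N" by (simp_all add: y_def N_def)
  have "y + 1 \<le> 2 powr (y + 1)"
    by (rule le_two_powr) (use y in simp)
  then have "(y + 1) ^ 4 \<le> (2 powr (y + 1)) ^ 4" using y by (intro power_mono) auto
  also have "\<dots> = 2 powr (4 * (y + 1))" by (simp add: powr_power mult.commute)
  finally have p: "(y + 1) ^ 4 \<le> 2 powr (4 * (y + 1))" .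
  have "real N + 1 \<le> (y + 1)\<^sup>2" using y by (simp add: power2_sum)
  then have "(real N + 1)\<^sup>2 \<le> ((y + 1)\<^sup>2)\<^sup>2" by (intro power_mono) auto
  also have "((y + 1)\<^sup>2)\<^sup>2 = (y + 1) ^ 4" by simp
  finally have N: "(real N + 1)\<^sup>2 \<le> 2 powr (4 * (y + 1))" using p by linarith
  have q: "real (ceil_sqrt (num_clauses \<phi>)) \<le> y + 1"
  proof -
    have "sqrt (real (num_clauses \<phi>)) \<le> y" unfolding y_def by (rule real_sqrt_le_mono) simp
    then show ?thesis using ceil_sqrt_le[of "num_clauses \<phi>"] by linarith
  qed
  have "real (2 ^ word_length (clauses \<phi>)) = 2 powr (15 * real (ceil_sqrt (num_clauses \<phi>)) + 1)"
    by (simp add: word_length_def num_clauses_def powr_add powr_realpow[symmetric] del: of_nat_power)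
       (simp add: powr_realpow[symmetric])
  also have "\<dots> \<le> 2 powr (16 * (y + 1))"
    using q y by (intro powr_mono) auto
  finally have w: "real (2 ^ word_length (clauses \<phi>)) \<le> 2 powr (16 * (y + 1))" .
  have "real (data_size (enc_cnf \<phi>)) \<le> real (20 * (N + 1)\<^sup>2)"
    using data_size_enc_cnf[OF assms(1)] unfolding N_def of_nat_le_iff .
  then have "real (data_size (enc_cnf \<phi>)) \<le> 20 * 2 powr (4 * (y + 1))"
    using N by (simp add: add.commute)
  moreover have "1 \<le> (2::real) powr (4 * (y + 1))" using y by (intro ge_one_powr_ge_zero) auto
  \<comment> \<open>\<open>20\<close> comes from the formula and \<open>2\<close> from the added
    constant. The factor \<open>2 powr 12\<close> fits because
    \<open>12 + 4 * (y + 1) \<le> 16 * (y + 1)\<close>.\<close>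
  moreover have "22 * (2::real) powr (4 * (y + 1)) \<le> 2 powr 12 * 2 powr (4 * (y + 1))"
    by (intro mult_right_mono) auto
  moreover have "2 powr 12 * 2 powr (4 * (y + 1)) \<le> (2::real) powr (16 * (y + 1))"
    unfolding powr_add[symmetric] using y by (intro powr_mono) auto
  moreover have "real (resource (num_vars \<phi>, clauses \<phi>) + 2)
      = real (data_size (enc_cnf \<phi>)) + real (2 ^ word_length (clauses \<phi>)) + 2"
    unfolding resource_def enc_cnf_eq by simp
  ultimately have "real (resource (num_vars \<phi>, clauses \<phi>) + 2) \<le> 2 * 2 powr (16 * (y + 1))"
    using w by linarith
  also have "\<dots> = 2 powr (16 * (y + 1) + 1)" by (simp add: powr_add)
  also have "\<dots> \<le> 2 powr (17 * (y + 1))" using y by (intro powr_mono) auto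
  finally show ?thesis .
qed

section \<open>From a crossword solver to a 3-SAT solver\<close>

lemma run_functional: "run p x \<omega> t b \<Longrightarrow> run p x \<omega> t' b' \<Longrightarrow> t = t' \<and> b = b'"
  unfolding run_def using exec_functional by blast

lemma runtime_le: "run p x \<omega> t b \<Longrightarrow> runtime p x \<omega> \<le> of_nat t"
  unfolding runtime_def by (rule INF_lower) blast

text \<open>The coin measure has total mass one, so a bound for all outcomes bounds the mean. This
  is how a deterministic solver meets the randomized hypothesis.\<close>

lemma expected_runtime_le:
  assumes "\<And>\<omega>. \<exists>t b. run p x \<omega> t b \<and> real t \<le> K"
  shows "expected_runtime p x \<le> ennreal K"
proof -
  interpret prob_space coins
    unfolding coins_def by (intro prob_space_PiM prob_space_measure_pmf)
  have "runtime p x \<omega> \<le> ennreal K" for \<omega>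
  proof -
    obtain t b where t: "run p x \<omega> t b" "real t \<le> K" using assms by blast
    have "runtime p x \<omega> \<le> of_nat t" by (rule runtime_le[OF t(1)])
    also have "of_nat t = ennreal (real t)" by (simp add: ennreal_of_nat_eq_real_of_nat)
    also have "\<dots> \<le> ennreal K" by (rule ennreal_leI[OF t(2)])
    finally show ?thesis .
  qed
  then have "expected_runtime p x \<le> (\<integral>\<^sup>+ \<omega>. ennreal K \<partial>coins)"
    unfolding expected_runtime_def by (intro nn_integral_mono)
  also have "\<dots> = ennreal K" by (simp add: emeasure_space_1)
  finally show ?thesis .
qed

lemma CP_Dec_solvable_imp_3sat:
  assumes solv: "CP_Dec_solvable {I. valid_crossword I \<and> distinct_slot_sizes I} (\<epsilon> / 676)" and \<epsilon>: "0 < \<epsilon>"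
  shows "\<exists>p C. solves_3sat_expected p (\<lambda>\<phi>. C * 2 powr (\<epsilon> * real (num_vars \<phi> + num_clauses \<phi>)))"
proof -
  define X where "X = {I :: bool crossword. valid_crossword I \<and> distinct_slot_sizes I}"
  \<comment> \<open>\<open>676 = 4 * 13\<^sup>2\<close>: squaring the slot number
    \<open>13 * q + 1\<close> costs a factor \<open>2 * 13\<^sup>2\<close> on the leading term, and
    the remaining factor \<open>2\<close> saves half of \<epsilon>.\<close>
  define \<delta> where "\<delta> = \<epsilon> / 676"
  obtain p C c where p: "solves_CP_Dec p X
     (\<lambda>I. C * 2 powr (\<delta> * real (num_slots I) ^ 2) * real (num_words I + input_size I) ^ c)"
    using solv unfolding CP_Dec_solvable_def X_def \<delta>_def by blast
  obtain r M T where r: "polybd resource (\<lambda>x. data_size (enc_instance (reduce x)))"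
    "computes r M T enc_formula enc_instance reduce" "polybd resource T"
    using ptime_reduce by (rule ptime_inE)
  obtain d where d: "\<And>x. T x \<le> (resource x + 2) ^ d"
    using r(3) unfolding polybd_def by blast
  obtain d' where d': "\<And>x. data_size (enc_instance (reduce x)) \<le> (resource x + 2) ^ d'"
    using r(1) unfolding polybd_def by blast
  \<comment> \<open>\<open>d\<close> is for the reduction. In the solver's polynomial factor, of
    degree \<open>c\<close>, the size of the produced instance has exponent \<open>d'\<close>; one
    more power absorbs the factor \<open>2\<close> from adding the number of words.\<close>
  define D where "D = d + Suc d' * c"
  \<comment> \<open>The absolute value admits a negative \<open>C\<close>, and \<open>+ 1\<close>
    pays for the reduction. The exponent collects what the estimates of the solver's exponential
    factor and of the polynomial overhead leave over.\<close>
  define K where "K = (\<bar>C\<bar> + 1) * 2 powr (392 * \<delta> + 17 * real D + (17 * real D)\<^sup>2 / (2 * \<epsilon>))"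
  have main: "\<exists>t. run (Seq r p) (enc_cnf \<phi>) \<omega> t (satisfiable \<phi>) \<and>
      real t \<le> K * 2 powr (\<epsilon> * real (num_vars \<phi> + num_clauses \<phi>))" if \<phi>: "is_3cnf \<phi>" for \<phi> \<omega>
  proof -
    define x where "x = (num_vars \<phi>, clauses \<phi>)"
    define q where "q = ceil_sqrt (num_clauses \<phi>)"
    interpret R: reduction "num_vars \<phi>" q "clauses \<phi>"
    proof
      show "length (clauses \<phi>) \<le> q * q"
        using le_ceil_sqrt_square by (simp add: q_def num_clauses_def)
    qed (use \<phi> in \<open>auto simp: is_3cnf_def\<close>)
    have l: "R.l = word_length (clauses \<phi>)"
      unfolding R.l_def R.k_def by (simp add: word_length_def q_def num_clauses_def)
    have I: "R.I = mk_crossword (reduce x)"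
      unfolding R.I_def l by (simp add: reduce_def x_def q_def num_clauses_def)
    have enc: "enc_crossword R.I = enc_instance (reduce x)"
      unfolding I enc_mk_crossword ..
    have fill: "completely_fillable R.I \<longleftrightarrow> satisfiable \<phi>"
      using R.fillable_imp_satisfiable R.satisfiable_imp_fillable unfolding satisfiable_def by blast
    let ?s = "(\<lambda>_. NIL)(0 := enc_cnf \<phi>) :: store"
    have "runs r ?s (T x) (?s(0 := enc_instance (reduce x)))"
      by (rule computesD[OF r(2)]) (simp_all add: x_def enc_cnf_eq clean_def)
    \<comment> \<open>The reduction leaves all variables but \<open>0\<close> at \<open>NIL\<close>
      and uses no coin, so the solver starts exactly as in a run of its own.\<close>
    then obtain t1 where t1: "t1 \<le> T x" "exec \<omega> r (?s, 0) t1 ((\<lambda>_. NIL)(0 := enc_crossword R.I), 0)"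
      unfolding runs_def enc by fastforce
    have "R.I \<in> X" using R.valid R.distinct_sizes by (simp add: X_def)
    then obtain t2 where t2: "run p (enc_crossword R.I) \<omega> t2 (satisfiable \<phi>)"
      "real t2 \<le> C * 2 powr (\<delta> * real (num_slots R.I) ^ 2) * real (num_words R.I + input_size R.I) ^ c"
      using p unfolding solves_CP_Dec_def fill[symmetric] by blast
    have run: "run (Seq r p) (enc_cnf \<phi>) \<omega> (t1 + t2) (satisfiable \<phi>)"
      using t2(1) exec.Seq[OF t1(2)] unfolding run_def by blast
    define N where "N = num_vars \<phi> + num_clauses \<phi>"
    define y where "y = sqrt (real N)"
    have y: "0 \<le> y" "y\<^sup>2 = real N" by (simp_all add: y_def)
    define A where "A = real (resource x + 2)"
    have A: "2 \<le> A" "A \<le> 2 powr (17 * (y + 1))"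
      using resource_le[OF \<phi>] by (simp_all add: A_def x_def y_def N_def)
    define E where "E = 2 powr (\<delta> * real (13 * q + 1) ^ 2)"
    have \<delta>: "0 < \<delta>" using \<epsilon> by (simp add: \<delta>_def)
    have E: "1 \<le> E" unfolding E_def using \<delta> by (intro ge_one_powr_ge_zero) auto
    have "real t1 \<le> A ^ d"
      using order_trans[OF t1(1) d[of x]] unfolding A_def of_nat_power[symmetric] of_nat_le_iff .
    also have "\<dots> \<le> A ^ D" using A by (intro power_increasing) (auto simp: D_def)
    also have "\<dots> \<le> E * A ^ D" using E A by simp
    finally have b1: "real t1 \<le> E * A ^ D" .
    have inp: "real (input_size R.I) \<le> A ^ d'"
      using d'[of x] unfolding input_size_def enc A_def of_nat_power[symmetric] of_nat_le_iff .
    have "num_words R.I \<le> input_size R.I"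
      using length_le_data_size[of "dict R.I" "enc_list enc_bool"]
      unfolding num_words_def input_size_def enc_crossword_def by simp
    then have "real (num_words R.I + input_size R.I) \<le> 2 * A ^ d'" using inp by simp
    also have "\<dots> \<le> A ^ Suc d'" using A by simp
    finally have "real (num_words R.I + input_size R.I) ^ c \<le> (A ^ Suc d') ^ c"
      by (intro power_mono) auto
    also have "\<dots> = A ^ (Suc d' * c)" by (simp only: power_mult)
    also have "\<dots> \<le> A ^ D" using A by (intro power_increasing) (auto simp: D_def)
    finally have nw: "real (num_words R.I + input_size R.I) ^ c \<le> A ^ D" .
    have "real t2 \<le> C * E * real (num_words R.I + input_size R.I) ^ c"
      using t2(2) by (simp only: R.num_slots_I E_def)
    also have "\<dots> \<le> \<bar>C\<bar> * E * real (num_words R.I + input_size R.I) ^ c"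
      using E by (intro mult_right_mono) auto
    also have "\<dots> \<le> \<bar>C\<bar> * E * A ^ D"
      using E nw by (intro mult_left_mono) auto
    finally have "real (t1 + t2) \<le> (\<bar>C\<bar> + 1) * (E * A ^ D)"
      using b1 by (simp add: algebra_simps)
    also have "E * A ^ D \<le> 2 powr (392 * \<delta> + 17 * real D + (17 * real D)\<^sup>2 / (2 * \<epsilon>)) * 2 powr (\<epsilon> * real N)"
    proof -
      have "A ^ D \<le> (2 powr (17 * (y + 1))) ^ D" using A by (intro power_mono) auto
      also have "\<dots> = 2 powr (17 * real D * (y + 1))" by (simp add: powr_power mult_ac)
      finally have AD: "A ^ D \<le> 2 powr (17 * real D * (y + 1))" .
      have "real q \<le> y + 1"
      proof -
        have "sqrt (real (num_clauses \<phi>)) \<le> y" unfolding y_def N_def by (rule real_sqrt_le_mono) simp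
        then show ?thesis using ceil_sqrt_le[of "num_clauses \<phi>"] by (simp add: q_def)
      qed
      then have "real (13 * q + 1) \<le> 13 * y + 14" by simp
      then have "real (13 * q + 1) ^ 2 \<le> (13 * y + 14)\<^sup>2" by (intro power_mono) auto
      \<comment> \<open>An instance of
        \<open>(a + b)\<^sup>2 \<le> 2 * a\<^sup>2 + 2 * b\<^sup>2\<close>, with
        \<open>a = 13 * y\<close> and \<open>b = 14\<close>.\<close>
      also have "\<dots> \<le> 338 * y\<^sup>2 + 392"
        using zero_le_power2[of "13 * y - 14"] by (simp add: power2_eq_square algebra_simps)
      finally have "\<delta> * real (13 * q + 1) ^ 2 \<le> \<delta> * (338 * real N + 392)"
        using \<delta> y by (intro mult_left_mono) auto
      also have "\<dots> = \<epsilon> / 2 * real N + 392 * \<delta>" by (simp add: \<delta>_def algebra_simps)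
      finally have e1: "\<delta> * real (13 * q + 1) ^ 2 \<le> \<epsilon> / 2 * real N + 392 * \<delta>" .
      \<comment> \<open>Completing the square: the overhead is linear in \<open>y\<close>, so the
        unspent half of \<epsilon> times \<open>y\<^sup>2\<close> absorbs it up to a
        constant.\<close>
      have "0 \<le> (\<epsilon> * y - 17 * real D)\<^sup>2 / (2 * \<epsilon>)" using \<epsilon> by simp
      also have "\<dots> = \<epsilon> / 2 * y\<^sup>2 + (17 * real D)\<^sup>2 / (2 * \<epsilon>) - 17 * real D * y"
        using \<epsilon> by (simp add: power2_eq_square field_simps)
      finally have e2: "17 * real D * y \<le> \<epsilon> / 2 * real N + (17 * real D)\<^sup>2 / (2 * \<epsilon>)"
        using y by simp
      have "E * A ^ D \<le> E * 2 powr (17 * real D * (y + 1))"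
        using AD E by (intro mult_left_mono) auto
      also have "\<dots> = 2 powr (\<delta> * real (13 * q + 1) ^ 2 + 17 * real D * (y + 1))"
        by (simp add: E_def powr_add)
      also have "\<dots> \<le> 2 powr (392 * \<delta> + 17 * real D + (17 * real D)\<^sup>2 / (2 * \<epsilon>) + \<epsilon> * real N)"
        by (rule powr_mono) (use e1 e2 in \<open>simp_all add: distrib_left\<close>)
      finally show ?thesis by (simp add: powr_add)
    qed
    finally have "real (t1 + t2) \<le> K * 2 powr (\<epsilon> * real N)"
      by (simp add: K_def mult_left_mono mult.assoc)
    with run show ?thesis unfolding N_def by blast
  qed
  have "solves_3sat_expected (Seq r p) (\<lambda>\<phi>. K * 2 powr (\<epsilon> * real (num_vars \<phi> + num_clauses \<phi>)))"
    unfolding solves_3sat_expected_def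
  proof (intro allI impI conjI)
    fix \<phi> \<omega> t b assume "is_3cnf \<phi>" "run (Seq r p) (enc_cnf \<phi>) \<omega> t b"
    then show "b = satisfiable \<phi>" using main[of \<phi> \<omega>] run_functional by blast
  next
    fix \<phi> assume "is_3cnf \<phi>"
    then show "expected_runtime (Seq r p) (enc_cnf \<phi>) \<le> ennreal (K * 2 powr (\<epsilon> * real (num_vars \<phi> + num_clauses \<phi>)))"
      using main[of \<phi>] by (intro expected_runtime_le) blast
  qed
  then show ?thesis by blast
qed

lemma CP_Dec_solvable_antimono:
  assumes "CP_Dec_solvable X \<epsilon>" "Y \<subseteq> X"
  shows "CP_Dec_solvable Y \<epsilon>"
proof -
  obtain p C c where "solves_CP_Dec p X
      (\<lambda>I. C * 2 powr (\<epsilon> * real (num_slots I) ^ 2) * real (num_words I + input_size I) ^ c)"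
    using assms(1) unfolding CP_Dec_solvable_def by (elim exE)
  then have "solves_CP_Dec p Y
      (\<lambda>I. C * 2 powr (\<epsilon> * real (num_slots I) ^ 2) * real (num_words I + input_size I) ^ c)"
    using assms(2) unfolding solves_CP_Dec_def by (simp add: subset_iff)
  then show ?thesis unfolding CP_Dec_solvable_def by (intro exI)
qed

theorem theorem19:
  assumes "randomized_ETH"
  shows "(\<exists>\<epsilon>>0. \<not> CP_Dec_solvable {I. valid_crossword I} \<epsilon>) \<and>
         (\<exists>\<epsilon>>0. \<not> CP_Dec_solvable {I. valid_crossword I \<and> distinct_slot_sizes I} \<epsilon>)"
proof -
  obtain \<epsilon> where \<epsilon>: "0 < \<epsilon>"
    "\<not> (\<exists>p C. solves_3sat_expected p (\<lambda>\<phi>. C * 2 powr (\<epsilon> * real (num_vars \<phi> + num_clauses \<phi>))))"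
    using assms unfolding randomized_ETH_def by blast
  have distinct: "\<not> CP_Dec_solvable {I. valid_crossword I \<and> distinct_slot_sizes I} (\<epsilon> / 676)"
    using CP_Dec_solvable_imp_3sat \<epsilon> by blast
  moreover have "\<not> CP_Dec_solvable {I. valid_crossword I} (\<epsilon> / 676)"
  proof
    assume "CP_Dec_solvable {I. valid_crossword I} (\<epsilon> / 676)"
    then have "CP_Dec_solvable {I. valid_crossword I \<and> distinct_slot_sizes I} (\<epsilon> / 676)"
      by (rule CP_Dec_solvable_antimono) auto
    with distinct show False by simp
  qed
  moreover have "0 < \<epsilon> / 676" using \<epsilon>(1) by simp
  ultimately show ?thesis by (intro conjI exI[of _ "\<epsilon> / 676"])
qed

end
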